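(* For every $d\ge2$, $\Theta_d=\mathcal Z_{d,d}=\bigcup_{k\in\mathbb N}\mathcal Z_{d,k}=\mathrm{Conv}(\mathcal S_{d,d})$.
   Context: All random variables live on an atomless probability space. $\mathcal L^2$ is the set of non-degenerate real random variables with finite variance. For $X,Y\in\mathcal L^2$ and $r\in[-1,1]$, $(X,Y)$ has invariant correlation $r$ if $\mathrm{Corr}(X,Y)=\mathrm{Corr}(g(X),g(Y))=r$ for every measurable $g:\mathbb R\to\mathbb R$ with $g(X),g(Y)\in\mathcal L^2$. A $d$-dimensional random vector $\mathbf X=(X_1,\dots,X_d)$ (with components in $\mathcal L^2$) has invariant correlation matrix $R=(r_{ij})_{d\times d}$ if $(X_i,X_j)$ has invariant correlation $r_{ij}$ for all $i,j\in[d]$. $\Theta_d$ is the set of all $d\times d$ matrices that are invariant correlation matrices of some continuous $d$-dimensional random vector with identical marginals. A $d\times k$ categorical random matrix is a random matrix $\Gamma=(Z_{ij})_{d\times k}$ with entries in $\{0,1\}$ such that each row sums to $1$. $\mathcal Z_{d,k}$ is the set of all matrices $\mathbb E[\Gamma\Gamma^\top]$ with $\Gamma$ a $d\times k$ categorical random matrix. For a $k$-partition $\mathbf A=(A_1,\dots,A_k)$ of $[d]=\{1,\dots,d\}$ (some $A_s$ may be empty), the clique partition point $\Sigma^{\mathbf A}$ is the $d\times d$ matrix with entries $\Sigma^{\mathbf A}_{ij}=\sum_{s=1}^k\mathds 1_{\{i,j\in A_s\}}$. $\mathcal S_{d,k}$ is the set of all clique partition points over all $k$-partitions of $[d]$,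 and $\mathrm{Conv}$ denotes convex hull. *)

theory Defs
  imports "HOL-Probability.Probability"
begin

definition atomless_space :: "'a measure \<Rightarrow> bool" where
  "atomless_space M \<longleftrightarrow> prob_space M \<and>
     (\<forall>A\<in>sets M. measure M A > 0 \<longrightarrow>
        (\<exists>B\<in>sets M. B \<subseteq> A \<and> 0 < measure M B \<and> measure M B < measure M A))"

definition L2 :: "'a measure \<Rightarrow> ('a \<Rightarrow> real) \<Rightarrow> bool" where
  "L2 M Y \<longleftrightarrow> Y \<in> borel_measurable M \<and> integrable M (\<lambda>\<omega>. (Y \<omega>)^2)
     \<and> \<not> (\<exists>c. AE \<omega> in M. Y \<omega> = c)"

definition cov :: "'a measure \<Rightarrow> ('a \<Rightarrow> real) \<Rightarrow> ('a \<Rightarrow> real) \<Rightarrow> real" where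
  "cov M X Y = integral\<^sup>L M (\<lambda>\<omega>. (X \<omega> - integral\<^sup>L M X) * (Y \<omega> - integral\<^sup>L M Y))"

definition corr :: "'a measure \<Rightarrow> ('a \<Rightarrow> real) \<Rightarrow> ('a \<Rightarrow> real) \<Rightarrow> real" where
  "corr M X Y = cov M X Y / sqrt (cov M X X * cov M Y Y)"

definition inv_corr :: "'a measure \<Rightarrow> ('a \<Rightarrow> real) \<Rightarrow> ('a \<Rightarrow> real) \<Rightarrow> real \<Rightarrow> bool" where
  "inv_corr M X Y r \<longleftrightarrow> L2 M X \<and> L2 M Y \<and> r \<in> {-1..1} \<and> corr M X Y = r \<and>
     (\<forall>g \<in> borel_measurable (borel :: real measure).
        L2 M (g \<circ> X) \<and> L2 M (g \<circ> Y) \<longrightarrow> corr M (g \<circ> X) (g \<circ> Y) = r)"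

text \<open>\<Theta>_d: invariant correlation matrices of continuous random vectors
  (each marginal has no atoms) with identical marginals; d = CARD('n).\<close>
definition Theta :: "'a measure \<Rightarrow> (real^'n::finite^'n) set" where
  "Theta M = {R. \<exists>X :: 'n \<Rightarrow> 'a \<Rightarrow> real.
      (\<forall>i x. measure M {\<omega> \<in> space M. X i \<omega> = x} = 0) \<and>
      (\<forall>i j. distr M borel (X i) = distr M borel (X j)) \<and>
      (\<forall>i j. inv_corr M (X i) (X j) (R $ i $ j))}"

text \<open>\<Z>_{d,k}: matrices E[\<Gamma>\<Gamma>^T] for d x k categorical random matrices \<Gamma>;
  entry (i,s) of \<Gamma> at outcome \<omega> is Z i s \<omega>, for s < k.\<close>
definition Zset :: "'a measure \<Rightarrow> nat \<Rightarrow> (real^'n::finite^'n) set" where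
  "Zset M k = {R. \<exists>Z :: 'n \<Rightarrow> nat \<Rightarrow> 'a \<Rightarrow> real.
      (\<forall>i. \<forall>s<k. Z i s \<in> borel_measurable M) \<and>
      (\<forall>\<omega>\<in>space M. \<forall>i. (\<forall>s<k. Z i s \<omega> \<in> {0,1}) \<and> (\<Sum>s<k. Z i s \<omega>) = 1) \<and>
      R = (\<chi> i j. integral\<^sup>L M (\<lambda>\<omega>. \<Sum>s<k. Z i s \<omega> * Z j s \<omega>))}"

text \<open>k-partitions (A_0,...,A_{k-1}) of [d] = UNIV :: 'n set, parts may be empty.\<close>
definition kpartition :: "nat \<Rightarrow> (nat \<Rightarrow> 'n set) \<Rightarrow> bool" where
  "kpartition k A \<longleftrightarrow> (\<Union>s<k. A s) = UNIV \<and>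
     (\<forall>s<k. \<forall>t<k. s \<noteq> t \<longrightarrow> A s \<inter> A t = {})"

definition clique_point :: "nat \<Rightarrow> (nat \<Rightarrow> 'n::finite set) \<Rightarrow> real^'n^'n" where
  "clique_point k A = (\<chi> i j. \<Sum>s<k. if i \<in> A s \<and> j \<in> A s then 1 else 0)"

definition Sset :: "nat \<Rightarrow> (real^'n::finite^'n) set" where
  "Sset k = {clique_point k A | A. kpartition k A}"

end

theory Submission
  imports Defs
begin

text \<open>
  Every realisation of \<open>\<Gamma>\<Gamma>\<^sup>T\<close> is a clique partition point, so its expectation lies in the convex
  hull; conversely an atomless space carries a random clique partition with any prescribed weights.

  If \<open>X\<close> has invariant correlation matrix \<open>R\<close>, cut the line into \<open>k\<close> Borel cells that have probability
  \<open>1/k\<close> under the common marginal. Testing invariance on the indicators of the cells shows that the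
  categorical matrix recording the cell of each \<open>X\<^sub>i\<close> has second moment matrix \<open>1/k + (1 - 1/k) R\<close>
  entrywise. This lies in the hull, which is compact; let \<open>k\<close> tend to infinity.

  Conversely, draw a random clique partition and, independently of it, i.i.d. continuous variables, one
  for each block. Giving every index the variable of its block makes \<open>X\<^sub>i\<close> and \<open>X\<^sub>j\<close> equal with
  probability \<open>R\<^sub>i\<^sub>j\<close> and otherwise independent, so every transformation has correlation \<open>R\<^sub>i\<^sub>j\<close>.
  The i.i.d. variables come from fair bits, obtained by repeatedly halving the atomless space.
\<close>

section \<open>Atomless probability spaces\<close>

text \<open>When a set is split into two pieces of positive measure, one piece has at most half of
  its measure. Repeating this \<open>n\<close> times leaves at most
  \<open>measure M A / 2 ^ n\<close>, which eventually drops below \<open>e\<close>.\<close>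

lemma atomless_small_subset:
  assumes "atomless_space M" "A \<in> sets M" "measure M A > 0" "e > 0"
  shows "\<exists>B\<in>sets M. B \<subseteq> A \<and> 0 < measure M B \<and> measure M B \<le> e"
proof -
  interpret prob_space M using assms(1) by (simp add: atomless_space_def)
  have half: "\<exists>C\<in>sets M. C \<subseteq> B \<and> 0 < measure M C \<and> measure M C \<le> measure M B / 2"
    if B: "B \<in> sets M" "measure M B > 0" for B
  proof -
    obtain C where C: "C \<in> sets M" "C \<subseteq> B" "0 < measure M C" "measure M C < measure M B"
      using assms(1) B unfolding atomless_space_def by blast
    have "measure M (B - C) = measure M B - measure M C"
      using B C by (intro finite_measure_Diff) auto
    then have "measure M C \<le> measure M B / 2 \<or> 0 < measure M (B - C) \<and> measure M (B - C) \<le> measure M B / 2"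
      using C by auto
    moreover have "B - C \<in> sets M" "B - C \<subseteq> B" using B C by auto
    ultimately show ?thesis using C by blast
  qed
  have "\<exists>B\<in>sets M. B \<subseteq> A \<and> 0 < measure M B \<and> measure M B \<le> measure M A / 2 ^ n" for n
  proof (induction n)
    case 0
    then show ?case using assms by auto
  next
    case (Suc n)
    then obtain B where B: "B \<in> sets M" "B \<subseteq> A" "0 < measure M B" "measure M B \<le> measure M A / 2 ^ n"
      by blast
    obtain C where "C \<in> sets M" "C \<subseteq> B" "0 < measure M C" "measure M C \<le> measure M B / 2"
      using half[OF B(1,3)] by blast
    moreover have "measure M B / 2 \<le> measure M A / 2 ^ n / 2" using B by (intro divide_right_mono) auto
    ultimately show ?case using B
      by (intro bexI[of _ C]) (auto simp: mult.commute)
  qed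
  moreover obtain n where "measure M A / 2 ^ n \<le> e"
  proof -
    obtain n where "measure M A / e < 2 ^ n"
      using real_arch_pow[of 2] by auto
    then have "measure M A / 2 ^ n \<le> e" using assms(4) by (simp add: field_simps)
    then show ?thesis using that by blast
  qed
  ultimately show ?thesis by (meson order.trans)
qed

text \<open>Sierpinski's theorem. The set is built greedily: every step adjoins a piece of at least half
  the largest measure that still fits, so a gap left in the limit would bound all pieces from below.\<close>

theorem atomless_subset_of_measure:
  assumes "atomless_space M" "A \<in> sets M" "0 \<le> t" "t \<le> measure M A"
  shows "\<exists>B\<in>sets M. B \<subseteq> A \<and> measure M B = t"
proof -
  interpret prob_space M using assms(1) by (simp add: atomless_space_def)
  define fit where "fit B = {C \<in> sets M. C \<subseteq> A - B \<and> measure M B + measure M C \<le> t}" for B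
  have fit_large: "\<exists>C\<in>fit B. \<forall>D\<in>fit B. measure M D \<le> 2 * measure M C"
    if B: "measure M B \<le> t" for B
  proof -
    have ne: "{} \<in> fit B" using B by (auto simp: fit_def)
    define s where "s = (SUP C\<in>fit B. measure M C)"
    have bdd: "bdd_above (measure M ` fit B)" by (rule bdd_aboveI[of _ 1]) auto
    have le: "measure M D \<le> s" if "D \<in> fit B" for D
      unfolding s_def using bdd that by (rule cSUP_upper2) auto
    \<comment> \<open>The supremum \<open>s\<close> need not be attained. If it is not positive,
      every fitting set is null and \<open>{}\<close> serves; otherwise some fitting set exceeds
      \<open>s / 2\<close>, and that suffices.\<close>
    show ?thesis
    proof (cases "s \<le> 0")
      case True
      with le ne show ?thesis by (force intro!: bexI[of _ "{}"])
    next
      case False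
      then have "\<exists>x\<in>measure M ` fit B. s / 2 < x"
        using less_cSUP_iff[of "fit B" "measure M" "s / 2"] ne bdd by (auto simp: s_def)
      with le show ?thesis by force
    qed
  qed
  define add where "add B = (SOME C. C \<in> fit B \<and> (\<forall>D\<in>fit B. measure M D \<le> 2 * measure M C))" for B
  have add: "add B \<in> fit B" "\<And>D. D \<in> fit B \<Longrightarrow> measure M D \<le> 2 * measure M (add B)"
    if "measure M B \<le> t" for B
    using someI_ex[OF fit_large[OF that, unfolded Bex_def]] by (auto simp: add_def)
  define S where "S n = ((\<lambda>B. B \<union> add B) ^^ n) {}" for n
  have S_Suc: "S (Suc n) = S n \<union> add (S n)" for n by (simp add: S_def)
  have S: "S n \<in> sets M \<and> S n \<subseteq> A \<and> measure M (S n) \<le> t" for n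
  proof (induction n)
    case 0
    then show ?case using assms by (simp add: S_def)
  next
    case (Suc n)
    with add(1)[of "S n"] have *: "add (S n) \<in> sets M" "add (S n) \<subseteq> A - S n"
      "measure M (S n) + measure M (add (S n)) \<le> t" by (auto simp: fit_def)
    moreover have "measure M (S n \<union> add (S n)) = measure M (S n) + measure M (add (S n))"
      using * Suc by (intro finite_measure_Union) auto
    ultimately show ?case using Suc by (auto simp: S_Suc)
  qed
  define B where "B = (\<Union>n. S n)"
  have B: "B \<in> sets M" "B \<subseteq> A" using S by (auto simp: B_def)
  have lim: "(\<lambda>n. measure M (S n)) \<longlonglongrightarrow> measure M B"
    unfolding B_def using S by (intro finite_Lim_measure_incseq) (auto intro!: incseq_SucI simp: S_Suc)
  have Bt: "measure M B \<le> t" using S by (intro LIMSEQ_le_const2[OF lim]) auto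
  have "measure M B = t"
  proof (rule ccontr)
    assume "measure M B \<noteq> t"
    with Bt have gap: "measure M B < t" by simp
    moreover have "measure M (A - B) = measure M A - measure M B"
      using B assms by (intro finite_measure_Diff) auto
    ultimately obtain D where D: "D \<in> sets M" "D \<subseteq> A - B" "0 < measure M D" "measure M D \<le> t - measure M B"
      using atomless_small_subset[OF assms(1), of "A - B" "t - measure M B"] B assms by auto
    \<comment> \<open>\<open>D\<close> avoids the whole of \<open>B\<close> and is no larger than
      the final gap, so it was available at every stage. Each increment is therefore at least half
      of \<open>measure M D\<close>, while convergence of \<open>measure M (S n)\<close> forces the
      increments to 0.\<close>
    have step: "measure M D \<le> 2 * (measure M (S (Suc n)) - measure M (S n))" for n
    proof -
      have "measure M (S n) \<le> measure M B"
        using B by (intro finite_measure_mono) (auto simp: B_def)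
      then have "D \<in> fit (S n)" using D by (auto simp: fit_def B_def)
      moreover have "add (S n) \<in> fit (S n)" using add(1) S by auto
      then have "measure M (S (Suc n)) = measure M (S n) + measure M (add (S n))"
        unfolding S_Suc using S by (intro finite_measure_Union) (auto simp: fit_def)
      ultimately show ?thesis using add(2)[of "S n" D] S by simp
    qed
    have "(\<lambda>n. 2 * (measure M (S (Suc n)) - measure M (S n))) \<longlonglongrightarrow> 2 * (measure M B - measure M B)"
      by (intro tendsto_intros lim LIMSEQ_Suc)
    then have "measure M D \<le> 2 * (measure M B - measure M B)"
      by (rule LIMSEQ_le_const) (use step in auto)
    with D show False by simp
  qed
  with B show ?thesis by blast
qed

section \<open>Random elements with a prescribed finite law\<close>

text \<open>Disjoint events of probability \<open>p i\<close> are cut one after another out of what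
  is left of the space. Together they have probability 1, and \<open>N\<close> reports which of them
  occurred.\<close>

lemma atomless_finite_law:
  assumes "atomless_space M" "finite I" "\<And>i. i \<in> I \<Longrightarrow> 0 \<le> p i" "sum p I = 1"
  obtains N where "N \<in> measurable M (count_space I)"
    "\<And>i. i \<in> I \<Longrightarrow> measure M {\<omega> \<in> space M. N \<omega> = i} = p i"
proof -
  interpret prob_space M using assms(1) by (simp add: atomless_space_def)
  \<comment> \<open>The set \<open>A\<close> stays general, with an inequality in place of an
    equality, so that the induction hypothesis applies to the remainder
    \<open>A - B\<close>.\<close>
  have "\<exists>E. (\<forall>i\<in>I. E i \<in> sets M \<and> E i \<subseteq> A \<and> measure M (E i) = p i) \<and> disjoint_family_on E I"
    if "A \<in> sets M" "sum p I \<le> measure M A" for A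
    using assms(2,3) that
  proof (induction I arbitrary: A rule: finite_induct)
    case empty
    then show ?case by (auto simp: disjoint_family_on_def)
  next
    case (insert i I)
    have "0 \<le> sum p I" using insert by (intro sum_nonneg) auto
    then obtain B where B: "B \<in> sets M" "B \<subseteq> A" "measure M B = p i"
      using atomless_subset_of_measure[OF assms(1), of A "p i"] insert by auto
    have "measure M (A - B) = measure M A - measure M B"
      using B insert by (intro finite_measure_Diff) auto
    then have "sum p I \<le> measure M (A - B)" using insert B by auto
    then obtain E where "\<forall>i\<in>I. E i \<in> sets M \<and> E i \<subseteq> A - B \<and> measure M (E i) = p i" "disjoint_family_on E I"
      using insert.IH[of "A - B"] insert.prems B by auto
    with B insert.hyps show ?case
      by (intro exI[of _ "E(i := B)"]) (auto simp: disjoint_family_on_def)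
  qed
  from this[of "space M"] obtain E where E: "\<And>i. i \<in> I \<Longrightarrow> E i \<in> sets M"
    "\<And>i. i \<in> I \<Longrightarrow> measure M (E i) = p i" "disjoint_family_on E I"
    using assms(4) by (auto simp: prob_space)
  have "I \<noteq> {}" using assms(4) by auto
  then obtain i0 where i0: "i0 \<in> I" by blast
  \<comment> \<open>Outcomes outside all the events receive the default \<open>i0\<close>. They form
    the null set \<open>Rest\<close>, so the law at \<open>i0\<close> is unaffected.\<close>
  define N where "N \<omega> = (if \<exists>i\<in>I. \<omega> \<in> E i then THE i. i \<in> I \<and> \<omega> \<in> E i else i0)" for \<omega>
  have N_E: "N \<omega> = i" if "i \<in> I" "\<omega> \<in> E i" for \<omega> i
  proof -
    have "(THE i. i \<in> I \<and> \<omega> \<in> E i) = i"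
      using that E(3) by (intro the_equality) (auto simp: disjoint_family_on_def)
    with that show ?thesis by (auto simp: N_def)
  qed
  have N_out: "N \<omega> = i0" if "\<omega> \<notin> (\<Union>i\<in>I. E i)" for \<omega> using that by (auto simp: N_def)
  have N_I: "N \<omega> \<in> I" for \<omega> using N_E N_out i0 by (cases "\<omega> \<in> (\<Union>i\<in>I. E i)") auto
  define Rest where "Rest = space M - (\<Union>i\<in>I. E i)"
  have Rest: "Rest \<in> sets M" using E assms(2) by (auto simp: Rest_def)
  have "measure M (\<Union>i\<in>I. E i) = 1"
    using E assms by (subst finite_measure_finite_Union) auto
  then have Rest0: "measure M Rest = 0"
    unfolding Rest_def using E assms(2) by (subst prob_compl) auto
  have N_eq: "{\<omega> \<in> space M. N \<omega> = i} = E i \<union> (if i = i0 then Rest else {})" if "i \<in> I" for i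
  proof (intro set_eqI)
    fix \<omega>
    show "\<omega> \<in> {\<omega> \<in> space M. N \<omega> = i} \<longleftrightarrow> \<omega> \<in> E i \<union> (if i = i0 then Rest else {})"
    proof (cases "\<omega> \<in> (\<Union>i\<in>I. E i)")
      case True
      then obtain j where "j \<in> I" "\<omega> \<in> E j" by blast
      with N_E[of j \<omega>] N_E[OF that, of \<omega>] sets.sets_into_space[OF E(1)] show ?thesis
        by (auto simp: Rest_def)
    next
      case False
      with N_out[of \<omega>] that show ?thesis by (auto simp: Rest_def)
    qed
  qed
  have "N \<in> measurable M (count_space I)"
  proof (rule measurable_count_space_eq2[THEN iffD2, OF assms(2)], safe)
    fix i assume "i \<in> I"
    then show "N -` {i} \<inter> space M \<in> sets M"
      using N_eq[of i] E(1) Rest by (auto simp add: vimage_def Collect_conj_eq Int_commute)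
  qed (use N_I in auto)
  moreover have "measure M {\<omega> \<in> space M. N \<omega> = i} = p i" if "i \<in> I" for i
    using N_eq[OF that] E Rest Rest0 that measure_Un_null_set[of "E i" M Rest] by (auto simp: emeasure_eq_measure null_sets_def)
  ultimately show ?thesis using that by blast
qed

text \<open>Without point masses, the distribution function of \<open>Q\<close> restricted to a set
  \<open>A\<close> is continuous. The intermediate value theorem then yields a half line that
  contains exactly half of the mass of \<open>A\<close>.\<close>

lemma atomless_space_borel:
  fixes Q :: "real measure"
  assumes "prob_space Q" "sets Q = sets borel" "\<And>x. measure Q {x} = 0"
  shows "atomless_space Q"
proof -
  interpret prob_space Q by fact
  have "\<exists>B\<in>sets Q. B \<subseteq> A \<and> 0 < measure Q B \<and> measure Q B < measure Q A"
    if A: "A \<in> sets Q" "measure Q A > 0" for A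
  proof -
    \<comment> \<open>\<open>D\<close> is the restriction of \<open>Q\<close> to \<open>A\<close>,
      left unnormalised: its total mass is \<open>measure Q A\<close>.\<close>
    define D where "D = density Q (indicator A)"
    have D: "measure D X = measure Q (A \<inter> X)" if "X \<in> sets Q" for X
      using that A by (simp add: D_def measure_def emeasure_restricted)
    have spQ: "space Q = UNIV" using sets_eq_imp_space_eq[OF assms(2)] by simp
    have "emeasure D (space D) \<noteq> \<infinity>"
      unfolding D_def using A by (simp add: emeasure_restricted emeasure_eq_measure)
    then interpret D: finite_borel_measure D
      by (intro finite_borel_measure.intro finite_measureI finite_borel_measure_axioms.intro)
        (simp_all add: D_def assms(2))
    have pt: "measure D {x} = 0" for x
    proof -
      have "measure Q (A \<inter> {x}) \<le> measure Q {x}"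
        using assms(2) by (intro finite_measure_mono) auto
      then show ?thesis using D[of "{x}"] assms(2,3) by (simp add: measure_le_0_iff)
    qed
    then have cont: "isCont (cdf D) x" for x by (simp add: D.isCont_cdf)
    have tot: "measure D (space D) = measure Q A"
      using D[of UNIV] spQ A sets.top[of Q] by (simp add: D_def)
    define m where "m = measure Q A"
    have m: "m > 0" using A by (simp add: m_def)
    have "eventually (\<lambda>x. cdf D x < m / 2) at_bot"
      using D.cdf_lim_at_bot m by (intro order_tendstoD) auto
    then obtain a where a: "cdf D a < m / 2" by (auto simp: eventually_at_bot_linorder)
    have "eventually (\<lambda>x. cdf D x > m / 2) at_top"
      using D.cdf_lim_at_top m by (intro order_tendstoD) (auto simp: tot m_def)
    then obtain b where b: "cdf D b > m / 2" by (auto simp: eventually_at_top_linorder)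
    have "a \<le> b" using a b D.cdf_nondecreasing[of b a] by (cases "a \<le> b") auto
    then obtain x where "cdf D x = m / 2"
      using IVT[of "cdf D" a "m / 2" b] a b cont by auto
    then have "measure Q (A \<inter> {..x}) = m / 2" using D[of "{..x}"] assms(2) by (simp add: cdf_def)
    then show ?thesis using A m assms(2) by (intro bexI[of _ "A \<inter> {..x}"]) (auto simp: m_def)
  qed
  then show ?thesis using assms(1) by (auto simp: atomless_space_def)
qed

section \<open>Independent continuous variables\<close>

text \<open>The number \<open>card (A j) / 2\<close> is the probability that a fair coin lands in
  \<open>A j\<close>, so one product formula states fairness and independence together. With sets
  instead of single values, an unconstrained bit can be included as \<open>UNIV\<close>, with factor
  1.\<close>

definition fair_bits :: "'a measure \<Rightarrow> ('i \<Rightarrow> 'a \<Rightarrow> bool) \<Rightarrow> bool" where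
  "fair_bits M b \<longleftrightarrow> (\<forall>n. b n \<in> measurable M (count_space UNIV)) \<and>
     (\<forall>J A. finite J \<longrightarrow>
        measure M {\<omega> \<in> space M. \<forall>j\<in>J. b j \<omega> \<in> A j} = (\<Prod>j\<in>J. real (card (A j)) / 2))"

lemma fair_bitsD:
  assumes "fair_bits M b"
  shows "b n \<in> measurable M (count_space UNIV)"
    and "finite J \<Longrightarrow> measure M {\<omega> \<in> space M. \<forall>j\<in>J. b j \<omega> \<in> A j} = (\<Prod>j\<in>J. real (card (A j)) / 2)"
  using assms by (auto simp: fair_bits_def)

lemma atomless_fair_bits:
  assumes "atomless_space M"
  obtains b :: "nat \<Rightarrow> 'a \<Rightarrow> bool" where "fair_bits M b"
proof -
  interpret prob_space M using assms by (simp add: atomless_space_def)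
  define H where "H A = (SOME B. B \<in> sets M \<and> B \<subseteq> A \<and> measure M B = measure M A / 2)" for A
  have H: "H A \<in> sets M" "H A \<subseteq> A" "measure M (H A) = measure M A / 2" if "A \<in> sets M" for A
  proof -
    have "\<exists>B. B \<in> sets M \<and> B \<subseteq> A \<and> measure M B = measure M A / 2"
      using atomless_subset_of_measure[OF assms that, of "measure M A / 2"] by auto
    from someI_ex[OF this] show "H A \<in> sets M" "H A \<subseteq> A" "measure M (H A) = measure M A / 2"
      by (auto simp: H_def)
  qed
  \<comment> \<open>\<open>W n \<omega>\<close> lists the first \<open>n\<close> bits of \<open>\<omega>\<close>, latest first; the next bit halves each cell on which \<open>W n\<close> is constant.\<close>
  define W :: "nat \<Rightarrow> 'a \<Rightarrow> bool list" where
    "W = rec_nat (\<lambda>\<omega>. []) (\<lambda>n w \<omega>. (\<omega> \<in> H {\<omega>'\<in>space M. w \<omega>' = w \<omega>}) # w \<omega>)"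
  define b where "b n \<omega> \<longleftrightarrow> \<omega> \<in> H {\<omega>'\<in>space M. W n \<omega>' = W n \<omega>}" for n \<omega>
  have W0: "W 0 \<omega> = []" and WS: "W (Suc n) \<omega> = b n \<omega> # W n \<omega>" for n \<omega>
    by (simp_all add: W_def b_def)
  have len: "length (W n \<omega>) = n" for n \<omega>
    by (induction n) (simp_all add: W0 WS)
  define L where "L n = {w::bool list. length w = n}" for n
  have finL: "finite (L n)" for n
    using finite_lists_length_eq[of "UNIV :: bool set" n] by (simp add: L_def)
  define E where "E n w = {\<omega>\<in>space M. W n \<omega> = w}" for n w
  \<comment> \<open>Prefixing \<open>w\<close> with the new bit \<open>c\<close> selects one of the
    two halves of the cell \<open>E n w\<close>.\<close>
  have E_Suc: "E (Suc n) (c # w) = (if c then H (E n w) else E n w - H (E n w))"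
    if "E n w \<in> sets M" for n c w
    using H(2)[OF that] by (auto simp: E_def WS b_def)
  have E_sets: "E n w \<in> sets M" for n w
  proof (induction n arbitrary: w)
    case 0
    have "E 0 w = (if w = [] then space M else {})" by (auto simp: E_def W0)
    then show ?case by simp
  next
    case (Suc n)
    show ?case
    proof (cases w)
      case Nil
      then have "E (Suc n) w = {}" by (auto simp: E_def WS)
      then show ?thesis by simp
    next
      case (Cons c v)
      then show ?thesis using E_Suc[OF Suc] H(1)[OF Suc] Suc by auto
    qed
  qed
  have half: "measure M (E (Suc n) (c # w)) = measure M (E n w) / 2" for n c w
    using E_Suc[OF E_sets] H[OF E_sets, of n w] E_sets[of n w]
      finite_measure_Diff[of "E n w" "H (E n w)"] by auto
  have bset: "{\<omega>\<in>space M. b n \<omega> = c} = (\<Union>w\<in>L n. E (Suc n) (c # w))" for n c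
    by (auto simp: E_def WS L_def len)
  have meas: "b n \<in> measurable M (count_space UNIV)" for n
  proof (rule measurable_count_space_eq2[THEN iffD2], simp, safe)
    fix c
    have "{\<omega>\<in>space M. b n \<omega> = c} \<in> sets M"
      unfolding bset using finL E_sets by auto
    then show "b n -` {c} \<inter> space M \<in> sets M"
      by (simp add: vimage_def Collect_conj_eq Int_commute)
  qed auto
  \<comment> \<open>The bit \<open>b n\<close> is fair and independent of all earlier bits: any
    event in terms of \<open>W n\<close> is a finite disjoint union of cells, and \<open>b n\<close>
    halves every one of them.\<close>
  have split: "measure M {\<omega>\<in>space M. W n \<omega> \<in> C \<and> b n \<omega> \<in> B} = measure M {\<omega>\<in>space M. W n \<omega> \<in> C} * (real (card B) / 2)"
    for n C B
  proof -
    have 1: "{\<omega>\<in>space M. W n \<omega> \<in> C} = (\<Union>w\<in>C \<inter> L n. E n w)"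
      by (auto simp: E_def L_def len)
    have 2: "{\<omega>\<in>space M. W n \<omega> \<in> C \<and> b n \<omega> \<in> B} = (\<Union>(w, c)\<in>(C \<inter> L n) \<times> B. E (Suc n) (c # w))"
      by (auto simp: E_def L_def len WS)
    have "measure M {\<omega>\<in>space M. W n \<omega> \<in> C} = (\<Sum>w\<in>C \<inter> L n. measure M (E n w))"
      unfolding 1 using finL E_sets
      by (intro finite_measure_finite_Union) (auto simp: disjoint_family_on_def E_def)
    moreover have "measure M {\<omega>\<in>space M. W n \<omega> \<in> C \<and> b n \<omega> \<in> B}
        = (\<Sum>x\<in>(C \<inter> L n) \<times> B. measure M (case x of (w, c) \<Rightarrow> E (Suc n) (c # w)))"
      unfolding 2 using finL E_sets
      by (intro finite_measure_finite_Union) (auto simp: disjoint_family_on_def E_def)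
    moreover have "\<dots> = (\<Sum>x\<in>(C \<inter> L n) \<times> B. measure M (E n (fst x)) / 2)"
      by (intro sum.cong) (auto simp: half)
    moreover have "\<dots> = (\<Sum>w\<in>C \<inter> L n. \<Sum>c\<in>B. measure M (E n w) / 2)"
      by (subst sum.cartesian_product) (simp add: case_prod_unfold)
    moreover have "\<dots> = (\<Sum>w\<in>C \<inter> L n. measure M (E n w)) * (real (card B) / 2)"
      unfolding sum_distrib_right by (simp add: mult.commute)
    ultimately show ?thesis by metis
  qed
  \<comment> \<open>Constraints on the first \<open>n\<close> bits amount to a condition on
    \<open>W n\<close>, which is the form that \<open>split\<close> needs.\<close>
  have hist: "\<exists>C. \<forall>\<omega>. (\<forall>j<n. b j \<omega> \<in> A j) \<longleftrightarrow> W n \<omega> \<in> C" for n A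
  proof (induction n)
    case 0
    then show ?case by auto
  next
    case (Suc n)
    then obtain C where C: "\<And>\<omega>. (\<forall>j<n. b j \<omega> \<in> A j) \<longleftrightarrow> W n \<omega> \<in> C" by blast
    then show ?case
      by (intro exI[of _ "{c # w | c w. c \<in> A n \<and> w \<in> C}"]) (auto simp: WS less_Suc_eq)
  qed
  have initial: "measure M {\<omega>\<in>space M. \<forall>j<n. b j \<omega> \<in> A j} = (\<Prod>j<n. real (card (A j)) / 2)" for n A
  proof (induction n)
    case 0
    then show ?case by (simp add: prob_space)
  next
    case (Suc n)
    obtain C where C: "\<And>\<omega>. (\<forall>j<n. b j \<omega> \<in> A j) \<longleftrightarrow> W n \<omega> \<in> C" using hist by blast
    have "{\<omega>\<in>space M. \<forall>j<Suc n. b j \<omega> \<in> A j} = {\<omega>\<in>space M. W n \<omega> \<in> C \<and> b n \<omega> \<in> A n}"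
      using C by (auto simp: less_Suc_eq)
    then show ?case using split Suc C by simp
  qed
  have "measure M {\<omega> \<in> space M. \<forall>j\<in>J. b j \<omega> \<in> A j} = (\<Prod>j\<in>J. real (card (A j)) / 2)" if J: "finite J" for J A
  proof -
    obtain n where n: "J \<subseteq> {..<n}" using finite_nat_iff_bounded J by blast
    \<comment> \<open>Bits below \<open>n\<close> that are not in \<open>J\<close> are left free.
      Their factor is 2 / 2 = 1, so they drop out of the product.\<close>
    define A' where "A' j = (if j \<in> J then A j else UNIV)" for j
    have "{\<omega> \<in> space M. \<forall>j\<in>J. b j \<omega> \<in> A j} = {\<omega> \<in> space M. \<forall>j<n. b j \<omega> \<in> A' j}"
      using n by (auto simp: A'_def)
    then have "measure M {\<omega> \<in> space M. \<forall>j\<in>J. b j \<omega> \<in> A j} = (\<Prod>j<n. real (card (A' j)) / 2)"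
      by (simp add: initial)
    also have "\<dots> = (\<Prod>j\<in>J. real (card (A j)) / 2)"
      using n by (intro prod.mono_neutral_cong_right) (auto simp: A'_def)
    finally show ?thesis .
  qed
  with meas have "fair_bits M b" by (auto simp: fair_bits_def)
  then show ?thesis using that by blast
qed

lemma fair_bits_compose_inj:
  fixes k :: "'b \<Rightarrow> 'i"
  assumes "fair_bits M b" "inj k"
  shows "fair_bits M (\<lambda>n. b (k n))"
  unfolding fair_bits_def
proof (intro conjI allI impI)
  fix J :: "'b set" and A assume J: "finite J"
  have inj: "inj_on k J" using assms(2) by (auto simp: inj_on_def)
  have inv: "inv k (k j) = j" for j using assms(2) by simp
  have "measure M {\<omega> \<in> space M. \<forall>j\<in>k ` J. b j \<omega> \<in> A (inv k j)} = (\<Prod>j\<in>k ` J. real (card (A (inv k j))) / 2)"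
    by (rule fair_bitsD(2)[OF assms(1) finite_imageI[OF J]])
  then show "measure M {\<omega> \<in> space M. \<forall>j\<in>J. b (k j) \<omega> \<in> A j} = (\<Prod>j\<in>J. real (card (A j)) / 2)"
    by (simp add: prod.reindex[OF inj] inv)
qed (use assms in \<open>auto simp: fair_bits_def\<close>)

text \<open>Applied to a singleton, the product formula identifies each factor as the probability of
  a single event; the formula for \<open>J\<close> is then the product rule.\<close>

lemma fair_bits_indep_vars:
  assumes "prob_space M" "fair_bits M b"
  shows "prob_space.indep_vars M (\<lambda>_. count_space UNIV) b UNIV"
proof -
  interpret prob_space M by fact
  have meas: "b n \<in> measurable M (count_space UNIV)" for n using assms(2) by (simp add: fair_bits_def)
  have law: "measure M {\<omega> \<in> space M. \<forall>j\<in>J. b j \<omega> \<in> A j} = (\<Prod>j\<in>J. real (card (A j)) / 2)" if "finite J" for J A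
    using assms(2) that by (simp add: fair_bits_def)
  show ?thesis
    unfolding indep_vars_def2
  proof (intro conjI ballI indep_setsI)
    fix A J
    assume J: "J \<noteq> {}" "finite J" and A: "\<forall>j\<in>J. A j \<in> {b j -` B \<inter> space M |B. B \<in> sets (count_space UNIV)}"
    then obtain B where B: "\<And>j. j \<in> J \<Longrightarrow> A j = b j -` B j \<inter> space M" by (simp) metis
    have "measure M (A j) = real (card (B j)) / 2" if "j \<in> J" for j
      using law[of "{j}" B] B[OF that] by (simp add: vimage_def Collect_conj_eq Int_commute)
    moreover have "(\<Inter>j\<in>J. A j) = {\<omega> \<in> space M. \<forall>j\<in>J. b j \<omega> \<in> B j}" using B J by auto
    ultimately show "prob (\<Inter>j\<in>J. A j) = (\<Prod>j\<in>J. prob (A j))"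
      using law[OF J(2), of B] by (metis (no_types, lifting) prod.cong)
  qed (use meas in \<open>auto intro: measurable_sets\<close>)
qed

text \<open>By independence the joint law is the product of the laws of the single bits, and each of
  these gives probability 1/2 to both values.\<close>

lemma fair_bits_distr_eq:
  fixes b b' :: "'i \<Rightarrow> 'a \<Rightarrow> bool"
  assumes "prob_space M" "fair_bits M b" "fair_bits M b'"
  shows "distr M (PiM UNIV (\<lambda>_. count_space UNIV)) (\<lambda>\<omega> n. b n \<omega>)
       = distr M (PiM UNIV (\<lambda>_. count_space UNIV)) (\<lambda>\<omega> n. b' n \<omega>)"
proof -
  interpret prob_space M by fact
  have meas: "c n \<in> measurable M (count_space UNIV)" if "fair_bits M c" for c and n :: 'i
    using that by (simp add: fair_bits_def)
  have single: "emeasure M (c n -` {x} \<inter> space M) = ennreal (1 / 2)" if "fair_bits M c" for c x and n :: 'i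
  proof -
    have "measure M {\<omega> \<in> space M. \<forall>j\<in>{n}. c j \<omega> \<in> {x}} = (\<Prod>j\<in>{n}. real (card {x}) / 2)"
      by (rule fair_bitsD(2)[OF that]) simp
    then have "measure M (c n -` {x} \<inter> space M) = 1 / 2"
      by (simp add: vimage_def Collect_conj_eq Int_commute)
    then show ?thesis by (simp only: emeasure_eq_measure)
  qed
  have bit: "distr M (count_space UNIV) (b n) = distr M (count_space UNIV) (b' n)" for n
    using meas[OF assms(2)] meas[OF assms(3)] single[OF assms(2)] single[OF assms(3)]
    by (intro measure_eqI_countable[of _ UNIV]) (auto simp: emeasure_distr)
  have "distr M (PiM UNIV (\<lambda>_. count_space UNIV)) (\<lambda>\<omega> n. c n \<omega>) = (\<Pi>\<^sub>M n\<in>UNIV. distr M (count_space UNIV) (c n))"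
    if "fair_bits M c" for c :: "'i \<Rightarrow> 'a \<Rightarrow> bool"
    using indep_vars_iff_distr_eq_PiM[where I = UNIV and M' = "\<lambda>_. count_space UNIV" and X = c, OF _ meas[OF that]]
      fair_bits_indep_vars[OF assms(1) that] by (simp add: restrict_UNIV)
  with assms bit show ?thesis by simp
qed

section \<open>Coding bit sequences injectively by reals\<close>

text \<open>Base 3 with digits 0 and 1 only, as in the Cantor set, keeps the coding injective. Base
  2 would identify some sequences with different tails.\<close>

definition ternary :: "(nat \<Rightarrow> bool) \<Rightarrow> real" where
  "ternary x = (\<Sum>n. of_bool (x n) / 3 ^ n)"

lemma summable_ternary: "summable (\<lambda>n. of_bool (x n) / 3 ^ n :: real)"
  by (rule summable_comparison_test'[OF summable_geometric[of "1/3"], of 0]) (auto simp: power_one_over)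

lemma ternary_bounds: "0 \<le> ternary x" "ternary x \<le> 3 / 2"
proof -
  show "0 \<le> ternary x" unfolding ternary_def by (intro suminf_nonneg summable_ternary) auto
  have "ternary x \<le> (\<Sum>n. (1/3) ^ n)"
    unfolding ternary_def by (intro suminf_le summable_ternary summable_geometric) (auto simp: power_one_over)
  also have "\<dots> = 3 / 2" by (subst suminf_geometric) auto
  finally show "ternary x \<le> 3 / 2" .
qed

lemma ternary_shift: "ternary x = (\<Sum>n<k. of_bool (x n) / 3 ^ n) + ternary (\<lambda>n. x (n + k)) / 3 ^ k"
proof -
  have "ternary x = (\<Sum>n. of_bool (x (n + k)) / 3 ^ (n + k)) + (\<Sum>n<k. of_bool (x n) / 3 ^ n)"
    unfolding ternary_def by (rule suminf_split_initial_segment[OF summable_ternary])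
  also have "(\<Sum>n. of_bool (x (n + k)) / 3 ^ (n + k) :: real) = (\<Sum>n. of_bool (x (n + k)) / 3 ^ n / 3 ^ k)"
    by (simp add: power_add)
  also have "\<dots> = ternary (\<lambda>n. x (n + k)) / 3 ^ k"
    unfolding ternary_def by (rule suminf_divide[OF summable_ternary])
  finally show ?thesis by simp
qed

text \<open>At the first index where two sequences differ, the digits contribute a difference of 1.
  The later digits contribute between 0 and 1/2 on each side, by \<open>ternary_bounds\<close>, and
  cannot make up for it.\<close>

lemma inj_ternary: "inj ternary"
proof (rule injI, rule ccontr)
  fix x y assume eq: "ternary x = ternary y" and "x \<noteq> y"
  then have ex: "\<exists>n. x n \<noteq> y n" by auto
  define k where "k = (LEAST n. x n \<noteq> y n)"
  have k: "x k \<noteq> y k" unfolding k_def using ex by (rule LeastI_ex)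
  have below: "x n = y n" if "n < k" for n using that not_less_Least unfolding k_def by blast
  have "ternary (\<lambda>n. x (n + k)) / 3 ^ k = ternary (\<lambda>n. y (n + k)) / 3 ^ k"
    using eq ternary_shift[of x k] ternary_shift[of y k] below by simp
  then have "ternary (\<lambda>n. x (n + k)) = ternary (\<lambda>n. y (n + k))" by simp
  moreover have "ternary (\<lambda>n. z (n + k)) = of_bool (z k) + ternary (\<lambda>n. z (n + 1 + k)) / 3" for z
    using ternary_shift[of "\<lambda>n. z (n + k)" 1] by simp
  ultimately show False
    using k ternary_bounds[of "\<lambda>n. x (n + 1 + k)"] ternary_bounds[of "\<lambda>n. y (n + 1 + k)"]
    by (cases "x k"; cases "y k") auto
qed

lemma ternary_measurable [measurable]: "ternary \<in> borel_measurable (PiM UNIV (\<lambda>_. count_space UNIV))"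
  unfolding ternary_def by measurable

text \<open>The fair bits are arranged in rows by \<open>prod_encode\<close>, and \<open>V m\<close>
  is the ternary value of row \<open>m\<close>. Disjointness of the rows gives independence, the
  common joint law of fair bits gives equal distributions, and injectivity of \<open>ternary\<close>
  excludes atoms.\<close>

theorem atomless_iid_continuous:
  assumes "atomless_space M"
  obtains V :: "nat \<Rightarrow> 'a \<Rightarrow> real" where
    "prob_space.indep_vars M (\<lambda>_. borel) V UNIV"
    "\<And>m. V m \<in> borel_measurable M"
    "\<And>m m'. distr M borel (V m) = distr M borel (V m')"
    "\<And>m x. measure M {\<omega> \<in> space M. V m \<omega> = x} = 0"
    "\<And>m \<omega>. \<bar>V m \<omega>\<bar> \<le> 2"
proof -
  interpret prob_space M using assms by (simp add: atomless_space_def)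
  obtain b :: "nat \<Rightarrow> 'a \<Rightarrow> bool" where b: "fair_bits M b" using atomless_fair_bits[OF assms] .
  define c where "c m n = b (prod_encode (m, n))" for m n
  have c: "fair_bits M (c m)" for m
    unfolding c_def by (rule fair_bits_compose_inj[OF b]) (auto simp: inj_on_def)
  have c_meas: "c m n \<in> measurable M (count_space UNIV)" for m n using c by (auto simp: fair_bits_def)
  have c_meas': "(\<lambda>\<omega> n. c m n \<omega>) \<in> measurable M (PiM UNIV (\<lambda>_. count_space UNIV))" for m
    using c_meas by (intro measurable_PiM_single') (auto simp: space_PiM)
  define V where "V m \<omega> = ternary (\<lambda>n. c m n \<omega>)" for m \<omega>
  have meas: "V m \<in> borel_measurable M" for m
    unfolding V_def using measurable_compose[OF c_meas' ternary_measurable] .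
  \<comment> \<open>\<open>K m\<close> is the set of positions of row \<open>m\<close>. Restrictions
    of an independent family to disjoint index sets are independent, and \<open>V m\<close> is a
    measurable function of the restriction to \<open>K m\<close>.\<close>
  define K where "K m = range (\<lambda>n. prod_encode (m, n))" for m
  have "indep_vars (\<lambda>m. PiM (K m) (\<lambda>_. count_space UNIV)) (\<lambda>m \<omega>. restrict (\<lambda>i. b i \<omega>) (K m)) UNIV"
    by (rule indep_vars_restrict[OF fair_bits_indep_vars[OF prob_space_axioms b]])
       (auto simp: K_def disjoint_family_on_def)
  then have "indep_vars (\<lambda>_. borel) (\<lambda>m \<omega>. ternary (\<lambda>n. restrict (\<lambda>i. b i \<omega>) (K m) (prod_encode (m, n)))) UNIV"
  proof (rule indep_vars_compose2)
    fix m
    have "(\<lambda>y n. y (prod_encode (m, n))) \<in> measurable (PiM (K m) (\<lambda>_. count_space UNIV)) (PiM UNIV (\<lambda>_. count_space (UNIV :: bool set)))"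
      by (intro measurable_PiM_single' measurable_component_singleton) (auto simp: space_PiM K_def)
    then show "(\<lambda>y. ternary (\<lambda>n. y (prod_encode (m, n)))) \<in> borel_measurable (PiM (K m) (\<lambda>_. count_space UNIV))"
      using measurable_compose[OF _ ternary_measurable] by blast
  qed
  then have indep: "indep_vars (\<lambda>_. borel) V UNIV"
    by (simp add: V_def[abs_def] c_def K_def)
  have "distr M borel (V m) = distr (distr M (PiM UNIV (\<lambda>_. count_space UNIV)) (\<lambda>\<omega> n. c m n \<omega>)) borel ternary" for m
    by (subst distr_distr[OF ternary_measurable c_meas']) (simp add: V_def[abs_def] comp_def)
  then have same: "distr M borel (V m) = distr M borel (V m')" for m m'
    using fair_bits_distr_eq[OF prob_space_axioms c c, of m m'] by simp
  have point: "measure M {\<omega> \<in> space M. V m \<omega> = x} = 0" for m x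
  proof (cases "x \<in> range ternary")
    case True
    then obtain y where y: "x = ternary y" by auto
    have "measure M {\<omega> \<in> space M. V m \<omega> = x} \<le> (1 / 2) ^ N" for N
    proof -
      \<comment> \<open>A value of \<open>V m\<close> determines the entire row, in particular its
        first \<open>N\<close> bits, and prescribing those has probability
        \<open>(1 / 2) ^ N\<close>.\<close>
      have "{\<omega> \<in> space M. V m \<omega> = x} \<subseteq> {\<omega> \<in> space M. \<forall>n\<in>{..<N}. c m n \<omega> \<in> {y n}}"
        by (auto simp: V_def y dest!: injD[OF inj_ternary])
      moreover have "{\<omega> \<in> space M. \<forall>n\<in>{..<N}. c m n \<omega> \<in> {y n}} \<in> sets M"
        using c_meas by (intro sets.sets_Collect_finite_All) (auto intro: measurable_sets_Collect)
      ultimately have "measure M {\<omega> \<in> space M. V m \<omega> = x} \<le> measure M {\<omega> \<in> space M. \<forall>n\<in>{..<N}. c m n \<omega> \<in> {y n}}"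
        by (intro finite_measure_mono)
      also have "\<dots> = (\<Prod>n\<in>{..<N}. real (card {y n}) / 2)"
        by (rule fair_bitsD(2)[OF c]) simp
      finally show ?thesis by simp
    qed
    then have "measure M {\<omega> \<in> space M. V m \<omega> = x} \<le> 0"
      by (intro LIMSEQ_le_const[OF LIMSEQ_power_zero[of "1 / 2 :: real"]]) auto
    then show ?thesis by (simp add: measure_le_0_iff)
  next
    case False
    then have "{\<omega> \<in> space M. V m \<omega> = x} = {}" by (auto simp: V_def)
    then show ?thesis by (simp only: measure_empty)
  qed
  have "\<bar>V m \<omega>\<bar> \<le> 2" for m \<omega> using ternary_bounds[of "\<lambda>n. c m n \<omega>"] by (simp add: V_def)
  with indep meas same point show ?thesis using that by blast
qed

section \<open>Clique partition points and categorical matrices\<close>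

text \<open>The blocks are the level sets of \<open>f\<close>. At most \<open>CARD('n)\<close> of
  them are nonempty, whatever the type of the labels, so they can be renumbered below
  \<open>CARD('n)\<close>. This is why more than d columns yield nothing new.\<close>

lemma clique_of_labelling_in_Sset:
  fixes f :: "'n::finite \<Rightarrow> 'b"
  shows "(\<chi> i j. of_bool (f i = f j)) \<in> (Sset CARD('n) :: (real^'n^'n) set)"
proof -
  obtain e :: "'n \<Rightarrow> nat" where e: "bij_betw e UNIV {..<CARD('n)}"
    using ex_bij_betw_finite_nat[of "UNIV :: 'n set"] by (auto simp: atLeast0LessThan)
  \<comment> \<open>Each block is represented by one of its members and takes the number that
    \<open>e\<close> gives to this member. Thus \<open>t\<close> separates the indices exactly as
    \<open>f\<close> does.\<close>
  define rep where "rep x = (SOME j. f j = x)" for x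
  have rep: "f (rep (f i)) = f i" for i unfolding rep_def by (rule someI) simp
  define t where "t i = e (rep (f i))" for i
  have t: "t i = t j \<longleftrightarrow> f i = f j" for i j
  proof
    assume "t i = t j"
    then have "rep (f i) = rep (f j)" using e by (auto simp: t_def bij_betw_def inj_on_def)
    then show "f i = f j" using rep by metis
  qed (simp add: t_def)
  have t_less: "t i < CARD('n)" for i using e by (auto simp: t_def bij_betw_def)
  define A where "A s = {i. t i = s}" for s
  have "kpartition CARD('n) A" using t_less by (auto simp: kpartition_def A_def)
  moreover have "(\<Sum>s<CARD('n). if i \<in> A s \<and> j \<in> A s then 1 else 0) = (of_bool (f i = f j) :: real)" for i j
  proof -
    have "(\<Sum>s<CARD('n). if i \<in> A s \<and> j \<in> A s then 1 else 0 :: real) = (\<Sum>s<CARD('n). if s = t i then of_bool (t i = t j) else 0)"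
      by (intro sum.cong) (auto simp: A_def)
    also have "\<dots> = of_bool (t i = t j)" using t_less by simp
    finally show ?thesis by (simp add: t)
  qed
  ultimately show ?thesis unfolding Sset_def clique_point_def by (auto intro!: exI[of _ A])
qed

text \<open>Every index lies in exactly one part, and the number of that part is its label.\<close>

lemma Sset_labelling:
  fixes P :: "real^'n::finite^'n"
  assumes "P \<in> Sset k"
  obtains f :: "'n \<Rightarrow> nat" where "\<And>i. f i < k" "P = (\<chi> i j. of_bool (f i = f j))"
proof -
  obtain A where A: "kpartition k A" "P = clique_point k A" using assms by (auto simp: Sset_def)
  have "\<forall>i. \<exists>s<k. i \<in> A s" using A(1) by (auto simp: kpartition_def)
  then obtain f where f: "\<And>i. f i < k" "\<And>i. i \<in> A (f i)" by metis
  have f_eq: "i \<in> A s \<longleftrightarrow> s = f i" if "s < k" for i s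
    using A(1) f that unfolding kpartition_def by blast
  have "(\<Sum>s<k. if i \<in> A s \<and> j \<in> A s then 1 else 0 :: real) = of_bool (f i = f j)" for i j
  proof -
    have "(\<Sum>s<k. if i \<in> A s \<and> j \<in> A s then 1 else 0 :: real) = (\<Sum>s<k. if s = f i then of_bool (f i = f j) else 0)"
      by (intro sum.cong) (auto simp: f_eq)
    then show ?thesis using f by simp
  qed
  then have "P = (\<chi> i j. of_bool (f i = f j))" unfolding A(2) clique_point_def by simp
  with f that show ?thesis by blast
qed

text \<open>There are only finitely many labellings with values below \<open>k\<close>. Finiteness
  turns hull membership into a single weighted sum over \<open>Sset k\<close>, and makes the hull
  compact.\<close>

lemma finite_Sset: "finite (Sset k :: (real^'n::finite^'n) set)"
proof (rule finite_subset)
  show "Sset k \<subseteq> (\<lambda>f. (\<chi> i j. of_bool (f i = f j)) :: real^'n^'n) ` (PiE UNIV (\<lambda>_. {..<k}))"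
    by (auto elim!: Sset_labelling simp: image_iff PiE_def extensional_def Pi_def)
qed (intro finite_imageI finite_PiE, auto)

text \<open>This is the probabilistic reading of the hull: \<open>u\<close> is the law of a random
  clique partition, \<open>F P\<close> labels the blocks of \<open>P\<close>, and each entry of
  \<open>R\<close> is the probability that its two indices share a block.\<close>

lemma hull_Sset_weights:
  fixes R :: "real^'n::finite^'n"
  assumes "R \<in> convex hull (Sset k)"
  obtains u and F :: "real^'n^'n \<Rightarrow> 'n \<Rightarrow> nat" where
    "\<And>P. P \<in> Sset k \<Longrightarrow> 0 \<le> u P" "sum u (Sset k) = 1" "\<And>P i. P \<in> Sset k \<Longrightarrow> F P i < k"
    "\<And>i j. R $ i $ j = (\<Sum>P\<in>Sset k. u P * of_bool (F P i = F P j))"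
proof -
  obtain u where u: "\<And>P. P \<in> Sset k \<Longrightarrow> 0 \<le> u P" "sum u (Sset k) = 1" "(\<Sum>P\<in>Sset k. u P *\<^sub>R P) = R"
    using assms by (auto simp: convex_hull_finite[OF finite_Sset])
  have "\<forall>P\<in>(Sset k :: (real^'n^'n) set). \<exists>f. (\<forall>i. f i < k) \<and> P = (\<chi> i j. of_bool (f i = f j))"
    by (auto elim: Sset_labelling)
  then obtain F where F: "\<And>P. P \<in> (Sset k :: (real^'n^'n) set) \<Longrightarrow> (\<forall>i. F P i < k) \<and> P = (\<chi> i j. of_bool (F P i = F P j))"
    by metis
  have "P $ i $ j = of_bool (F P i = F P j)" if "P \<in> Sset k" for P i j
    using arg_cong[OF conjunct2[OF F[OF that]], of "\<lambda>P. P $ i $ j"] by simp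
  then have "R $ i $ j = (\<Sum>P\<in>Sset k. u P * of_bool (F P i = F P j))" for i j
    unfolding u(3)[symmetric] by simp
  with u F that show ?thesis by blast
qed

section \<open>Second moments of categorical matrices and the convex hull\<close>

lemma ZsetI:
  fixes Z :: "'n::finite \<Rightarrow> nat \<Rightarrow> 'a \<Rightarrow> real"
  assumes "\<And>i s. s < k \<Longrightarrow> Z i s \<in> borel_measurable M"
    and "\<And>i s \<omega>. Z i s \<omega> \<in> {0, 1}"
    and "\<And>i \<omega>. \<omega> \<in> space M \<Longrightarrow> (\<Sum>s<k. Z i s \<omega>) = 1"
    and "\<And>i j. integral\<^sup>L M (\<lambda>\<omega>. \<Sum>s<k. Z i s \<omega> * Z j s \<omega>) = R $ i $ j"
  shows "R \<in> Zset M k"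
  unfolding Zset_def mem_Collect_eq
  by (intro exI[of _ Z] conjI allI impI ballI assms) (simp_all add: vec_eq_iff assms)

text \<open>The matrix \<Gamma>\<Gamma>^T takes finitely many values, all of them clique partition
  points. Its expectation is their average, weighted by the probabilities of the values.\<close>

lemma Zset_subset_hull:
  assumes "prob_space M"
  shows "(Zset M k :: (real^'n::finite^'n) set) \<subseteq> convex hull (Sset CARD('n))"
proof
  interpret prob_space M by fact
  fix R :: "real^'n^'n" assume "R \<in> Zset M k"
  then obtain Z :: "'n \<Rightarrow> nat \<Rightarrow> 'a \<Rightarrow> real" where
    Z: "\<And>i s. s < k \<Longrightarrow> Z i s \<in> borel_measurable M"
    "\<And>\<omega> i s. \<omega> \<in> space M \<Longrightarrow> s < k \<Longrightarrow> Z i s \<omega> \<in> {0, 1}"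
    "\<And>\<omega> i. \<omega> \<in> space M \<Longrightarrow> (\<Sum>s<k. Z i s \<omega>) = 1"
    and R: "R = (\<chi> i j. integral\<^sup>L M (\<lambda>\<omega>. \<Sum>s<k. Z i s \<omega> * Z j s \<omega>))"
    unfolding Zset_def by blast
  define S where "S = (Sset CARD('n) :: (real^'n^'n) set)"
  define G :: "'a \<Rightarrow> real^'n^'n" where "G \<omega> = (\<chi> i j. \<Sum>s<k. Z i s \<omega> * Z j s \<omega>)" for \<omega>
  have G_S: "G \<omega> \<in> S" if \<omega>: "\<omega> \<in> space M" for \<omega>
  proof -
    \<comment> \<open>A row of zeros and ones with sum 1 has exactly one entry 1. Its column serves
      as the label of the row.\<close>
    have "\<exists>t<k. \<forall>s<k. Z i s \<omega> = of_bool (s = t)" for i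
    proof -
      have "\<exists>t<k. Z i t \<omega> = 1"
      proof (rule ccontr)
        assume "\<not> ?thesis"
        then have "Z i s \<omega> = 0" if "s < k" for s using Z(2)[OF \<omega> that] that by blast
        then show False using Z(3)[OF \<omega>, of i] by simp
      qed
      then obtain t where t: "t < k" "Z i t \<omega> = 1" by blast
      have "(\<Sum>s\<in>{..<k} - {t}. Z i s \<omega>) = 0"
        using Z(3)[OF \<omega>, of i] t by (simp add: sum_diff1)
      then have "\<forall>s\<in>{..<k} - {t}. Z i s \<omega> = 0"
        using Z(2)[OF \<omega>, of _ i] by (subst (asm) sum_nonneg_eq_0_iff) fastforce+
      with t show ?thesis by (auto intro!: exI[of _ t])
    qed
    then obtain f where f: "\<And>i. f i < k" "\<And>i s. s < k \<Longrightarrow> Z i s \<omega> = of_bool (s = f i)" by metis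
    have "(\<Sum>s<k. Z i s \<omega> * Z j s \<omega>) = of_bool (f i = f j)" for i j
    proof -
      have "(\<Sum>s<k. Z i s \<omega> * Z j s \<omega>) = (\<Sum>s<k. if s = f i then of_bool (f i = f j) else 0)"
        by (intro sum.cong) (auto simp: f(2))
      then show ?thesis using f(1) by simp
    qed
    then show ?thesis using clique_of_labelling_in_Sset[of f] by (simp add: G_def S_def)
  qed
  have G_meas: "(\<lambda>\<omega>. G \<omega> $ i $ j) \<in> borel_measurable M" for i j
    unfolding G_def using Z(1) by (auto intro!: borel_measurable_sum borel_measurable_times)
  define E where "E P = {\<omega> \<in> space M. G \<omega> = P}" for P
  have E: "E P \<in> sets M" for P
  proof -
    have "E P = {\<omega> \<in> space M. \<forall>i j. G \<omega> $ i $ j = P $ i $ j}" by (auto simp: E_def vec_eq_iff)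
    also have "\<dots> \<in> sets M" using G_meas by measurable
    finally show ?thesis .
  qed
  have fin: "finite S" by (simp add: S_def finite_Sset)
  have "R $ i $ j = (\<Sum>P\<in>S. measure M (E P) *\<^sub>R P) $ i $ j" for i j
  proof -
    have "R $ i $ j = integral\<^sup>L M (\<lambda>\<omega>. G \<omega> $ i $ j)" by (simp add: R G_def)
    also have "\<dots> = integral\<^sup>L M (\<lambda>\<omega>. \<Sum>P\<in>S. indicator (E P) \<omega> * P $ i $ j)"
    proof (rule Bochner_Integration.integral_cong[OF refl])
      fix \<omega> assume \<omega>: "\<omega> \<in> space M"
      have "(\<Sum>P\<in>S. indicator (E P) \<omega> * P $ i $ j) = (\<Sum>P\<in>S. if P = G \<omega> then G \<omega> $ i $ j else 0)"
        using \<omega> by (intro sum.cong) (auto simp: E_def indicator_def)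
      then show "G \<omega> $ i $ j = (\<Sum>P\<in>S. indicator (E P) \<omega> * P $ i $ j)"
        using G_S[OF \<omega>] fin by simp
    qed
    also have "\<dots> = (\<Sum>P\<in>S. measure M (E P) * P $ i $ j)"
      using E by (subst Bochner_Integration.integral_sum) (auto intro!: integrable_mult_left integrable_real_indicator simp: emeasure_eq_measure)
    finally show ?thesis by simp
  qed
  then have "R = (\<Sum>P\<in>S. measure M (E P) *\<^sub>R P)" by (simp add: vec_eq_iff)
  moreover have "(\<Sum>P\<in>S. measure M (E P)) = 1"
  proof -
    have "(\<Sum>P\<in>S. measure M (E P)) = measure M (\<Union>P\<in>S. E P)"
      using fin E by (intro finite_measure_finite_Union[symmetric]) (auto simp: disjoint_family_on_def E_def)
    also have "(\<Union>P\<in>S. E P) = space M" using G_S by (auto simp: E_def)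
    finally show ?thesis by (simp add: prob_space)
  qed
  ultimately show "R \<in> convex hull (Sset CARD('n))"
    using fin unfolding S_def by (auto simp: convex_hull_finite intro!: exI[of _ "\<lambda>P. measure M (E P)"])
qed

text \<open>A clique point \<open>N\<close> is drawn with the weights \<open>u\<close>, and row
  \<open>i\<close> of the categorical matrix has its 1 in the column of the block of
  \<open>i\<close>. Two rows then have inner product 1 exactly when their indices share a
  block.\<close>

lemma hull_subset_Zset:
  assumes "atomless_space M"
  shows "convex hull (Sset k) \<subseteq> (Zset M k :: (real^'n::finite^'n) set)"
proof
  interpret prob_space M using assms by (simp add: atomless_space_def)
  fix R :: "real^'n^'n" assume R_hull: "R \<in> convex hull (Sset k)"
  obtain u and F :: "real^'n^'n \<Rightarrow> 'n \<Rightarrow> nat" where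
    u: "\<And>P. P \<in> Sset k \<Longrightarrow> 0 \<le> u P" "sum u (Sset k) = 1" and F: "\<And>P i. P \<in> Sset k \<Longrightarrow> F P i < k"
    and R: "\<And>i j. R $ i $ j = (\<Sum>P\<in>Sset k. u P * of_bool (F P i = F P j))"
    by (rule hull_Sset_weights[OF R_hull]) (rule that; assumption)
  obtain N where N: "N \<in> measurable M (count_space (Sset k :: (real^'n^'n) set))"
    "\<And>P. P \<in> Sset k \<Longrightarrow> measure M {\<omega> \<in> space M. N \<omega> = P} = u P"
    by (rule atomless_finite_law[OF assms finite_Sset u]) (assumption | rule that)+
  have N_S: "N \<omega> \<in> Sset k" if "\<omega> \<in> space M" for \<omega> using measurable_space[OF N(1) that] by simp
  define Z :: "'n \<Rightarrow> nat \<Rightarrow> 'a \<Rightarrow> real" where "Z i s \<omega> = of_bool (F (N \<omega>) i = s)" for i s \<omega>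
  have Z_meas: "Z i s \<in> borel_measurable M" for i s
    unfolding Z_def by (rule measurable_compose[OF N(1)]) simp
  have Z_sum: "(\<Sum>s<k. Z i s \<omega> * Z j s \<omega>) = of_bool (F (N \<omega>) i = F (N \<omega>) j)" if "\<omega> \<in> space M" for i j \<omega>
  proof -
    have "(\<Sum>s<k. Z i s \<omega> * Z j s \<omega>) = (\<Sum>s<k. if s = F (N \<omega>) i then of_bool (F (N \<omega>) i = F (N \<omega>) j) else 0)"
      by (intro sum.cong) (auto simp: Z_def)
    then show ?thesis using F[OF N_S[OF that]] by simp
  qed
  have Z_row: "(\<Sum>s<k. Z i s \<omega>) = 1" if "\<omega> \<in> space M" for i \<omega>
    using F[OF N_S[OF that]] by (simp add: Z_def of_bool_def)
  have ev: "{\<omega> \<in> space M. N \<omega> = P} \<in> sets M" if "P \<in> Sset k" for P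
    using measurable_sets[OF N(1), of "{P}"] that by (simp add: vimage_def Collect_conj_eq Int_commute)
  have "R $ i $ j = integral\<^sup>L M (\<lambda>\<omega>. \<Sum>s<k. Z i s \<omega> * Z j s \<omega>)" for i j
  proof -
    have "integral\<^sup>L M (\<lambda>\<omega>. \<Sum>s<k. Z i s \<omega> * Z j s \<omega>)
        = integral\<^sup>L M (\<lambda>\<omega>. \<Sum>P\<in>Sset k. indicator {\<omega> \<in> space M. N \<omega> = P} \<omega> * of_bool (F P i = F P j))"
    proof (rule Bochner_Integration.integral_cong[OF refl])
      fix \<omega> assume \<omega>: "\<omega> \<in> space M"
      have "(\<Sum>P\<in>Sset k. indicator {\<omega> \<in> space M. N \<omega> = P} \<omega> * of_bool (F P i = F P j))
          = (\<Sum>P\<in>Sset k. if P = N \<omega> then of_bool (F (N \<omega>) i = F (N \<omega>) j) else 0 :: real)"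
        using \<omega> by (intro sum.cong) (auto simp: indicator_def)
      then show "(\<Sum>s<k. Z i s \<omega> * Z j s \<omega>) = (\<Sum>P\<in>Sset k. indicator {\<omega> \<in> space M. N \<omega> = P} \<omega> * of_bool (F P i = F P j))"
        using N_S[OF \<omega>] Z_sum[OF \<omega>] by (simp add: finite_Sset)
    qed
    also have "\<dots> = (\<Sum>P\<in>Sset k. measure M {\<omega> \<in> space M. N \<omega> = P} * of_bool (F P i = F P j))"
      using ev by (subst Bochner_Integration.integral_sum) (auto intro!: integrable_mult_left integrable_real_indicator simp: emeasure_eq_measure)
    also have "\<dots> = R $ i $ j" using N(2) R by simp
    finally show ?thesis by simp
  qed
  then show "R \<in> Zset M k"
    by (intro ZsetI[of k Z]) (simp_all add: Z_meas Z_row, simp add: Z_def)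
qed

section \<open>Invariant correlation\<close>

lemma L2_integrable:
  assumes "prob_space M" "L2 M X"
  shows "integrable M X"
proof -
  interpret prob_space M by fact
  show ?thesis
    using assms(2) by (auto simp: L2_def intro: square_integrable_imp_integrable)
qed

lemma L2_integrable_mult:
  assumes "L2 M X" "L2 M Y"
  shows "integrable M (\<lambda>\<omega>. X \<omega> * Y \<omega>)"
proof (rule Bochner_Integration.integrable_bound[where f = "\<lambda>\<omega>. (X \<omega>)^2 + (Y \<omega>)^2"])
  have "\<bar>x * y\<bar> \<le> \<bar>x\<^sup>2 + y\<^sup>2\<bar>" for x y :: real
  proof -
    have "2 * (\<bar>x\<bar> * \<bar>y\<bar>) \<le> x\<^sup>2 + y\<^sup>2"
      using sum_squares_bound[of "\<bar>x\<bar>" "\<bar>y\<bar>"] by simp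
    moreover have "0 \<le> \<bar>x\<bar> * \<bar>y\<bar>" by simp
    ultimately show ?thesis unfolding abs_mult by linarith
  qed
  then show "AE \<omega> in M. norm (X \<omega> * Y \<omega>) \<le> norm ((X \<omega>)\<^sup>2 + (Y \<omega>)\<^sup>2)" by simp
qed (use assms in \<open>auto simp: L2_def\<close>)

lemma cov_eq:
  assumes "prob_space M" "L2 M X" "L2 M Y"
  shows "cov M X Y = integral\<^sup>L M (\<lambda>\<omega>. X \<omega> * Y \<omega>) - integral\<^sup>L M X * integral\<^sup>L M Y"
proof -
  interpret prob_space M by fact
  note [simp] = L2_integrable[OF assms(1,2)] L2_integrable[OF assms(1,3)] L2_integrable_mult[OF assms(2,3)]
  have "cov M X Y = integral\<^sup>L M (\<lambda>\<omega>. X \<omega> * Y \<omega> - integral\<^sup>L M X * Y \<omega> - X \<omega> * integral\<^sup>L M Y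
      + integral\<^sup>L M X * integral\<^sup>L M Y)"
    unfolding cov_def by (simp add: algebra_simps)
  also have "\<dots> = integral\<^sup>L M (\<lambda>\<omega>. X \<omega> * Y \<omega>) - integral\<^sup>L M X * integral\<^sup>L M Y"
    by (simp add: prob_space)
  finally show ?thesis .
qed

text \<open>A vanishing variance would make \<open>X\<close> almost surely equal to its mean, which
  \<open>L2\<close> excludes.\<close>

lemma L2_variance_pos:
  assumes "prob_space M" "L2 M X"
  shows "cov M X X > 0"
proof -
  interpret prob_space M by fact
  let ?D = "\<lambda>\<omega>. (X \<omega> - integral\<^sup>L M X) * (X \<omega> - integral\<^sup>L M X)"
  have "integrable M ?D"
    using L2_integrable[OF assms] L2_integrable_mult[OF assms(2,2)]
    by (simp add: algebra_simps)
  then have "integral\<^sup>L M ?D = 0 \<longleftrightarrow> (AE \<omega> in M. ?D \<omega> = 0)"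
    by (intro integral_nonneg_eq_0_iff_AE) auto
  then have "integral\<^sup>L M ?D \<noteq> 0" using assms(2) by (auto simp: L2_def)
  moreover have "integral\<^sup>L M ?D \<ge> 0" by (intro integral_nonneg_AE) auto
  ultimately show ?thesis unfolding cov_def by linarith
qed

text \<open>For equal first and second moments the variances agree and are positive, so clearing the
  denominator makes the condition on the correlation affine in \<open>r\<close>. Both inclusions for
  \<open>Theta\<close> work with this form.\<close>

lemma corr_eq_same_moments:
  assumes "prob_space M" "L2 M X" "L2 M Y" "integral\<^sup>L M Y = integral\<^sup>L M X"
    and "integral\<^sup>L M (\<lambda>\<omega>. Y \<omega> * Y \<omega>) = integral\<^sup>L M (\<lambda>\<omega>. X \<omega> * X \<omega>)"
  shows "corr M X Y = r \<longleftrightarrow> integral\<^sup>L M (\<lambda>\<omega>. X \<omega> * Y \<omega>)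
    = r * integral\<^sup>L M (\<lambda>\<omega>. X \<omega> * X \<omega>) + (1 - r) * (integral\<^sup>L M X)\<^sup>2"
proof -
  define v where "v = cov M X X"
  have v: "v > 0" using L2_variance_pos assms by (simp add: v_def)
  have vY: "cov M Y Y = v" unfolding v_def using assms by (simp add: cov_eq)
  have vX: "v = integral\<^sup>L M (\<lambda>\<omega>. X \<omega> * X \<omega>) - (integral\<^sup>L M X)\<^sup>2"
    unfolding v_def using assms by (simp add: cov_eq power2_eq_square)
  have "corr M X Y = (integral\<^sup>L M (\<lambda>\<omega>. X \<omega> * Y \<omega>) - (integral\<^sup>L M X)\<^sup>2) / v"
    using v assms by (simp add: corr_def vY v_def[symmetric] cov_eq power2_eq_square)
  then have "corr M X Y = r \<longleftrightarrow> integral\<^sup>L M (\<lambda>\<omega>. X \<omega> * Y \<omega>) - (integral\<^sup>L M X)\<^sup>2 = r * v"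
    using v by (metis nonzero_divide_eq_eq order_less_irrefl)
  then show ?thesis unfolding vX by (simp add: algebra_simps)
qed

section \<open>Invariant correlation matrices and the convex hull\<close>

lemma Theta_subset_hull:
  assumes "prob_space M"
  shows "(Theta M :: (real^'n::finite^'n) set) \<subseteq> convex hull (Sset CARD('n))"
proof
  interpret prob_space M by fact
  fix R :: "real^'n^'n" assume "R \<in> Theta M"
  then obtain X :: "'n \<Rightarrow> 'a \<Rightarrow> real" where
    cont: "\<And>i x. measure M {\<omega> \<in> space M. X i \<omega> = x} = 0"
    and same: "\<And>i j. distr M borel (X i) = distr M borel (X j)"
    and inv: "\<And>i j. inv_corr M (X i) (X j) (R $ i $ j)"
    unfolding Theta_def by blast
  have X_meas [measurable]: "X i \<in> borel_measurable M" for i using inv[of i i] by (simp add: inv_corr_def L2_def)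
  \<comment> \<open>\<open>undefined\<close> is merely some index; all marginals coincide.\<close>
  define Q where "Q = distr M borel (X undefined)"
  have Q: "distr M borel (X i) = Q" for i unfolding Q_def by (rule same)
  interpret Q: prob_space Q unfolding Q_def by (rule prob_space_distr) simp
  have sQ: "sets Q = sets borel" "space Q = UNIV" by (simp_all add: Q_def)
  have "measure Q {x} = 0" for x
    using cont[of undefined x] by (simp add: Q_def measure_distr vimage_def Collect_conj_eq Int_commute)
  then have atomless: "atomless_space Q"
    by (intro atomless_space_borel Q.prob_space_axioms sQ)
  \<comment> \<open>The matrix differs from \<open>R\<close> by (1 - R)/k entrywise. Taking
    \<open>k \<ge> 2\<close> keeps the indicators of the cells non-degenerate, so that invariance
    can be tested on them.\<close>
  have approx: "(\<chi> i j. 1 / real k + R $ i $ j * (1 - 1 / real k)) \<in> convex hull (Sset CARD('n) :: (real^'n^'n) set)"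
    if k: "k \<ge> 2" for k
  proof -
    have unif: "0 \<le> 1 / real k" "(\<Sum>s<k. 1 / real k) = 1" using k by auto
    obtain N where N: "N \<in> measurable Q (count_space {..<k})"
      "\<And>s. s \<in> {..<k} \<Longrightarrow> measure Q {x \<in> space Q. N x = s} = 1 / real k"
      by (rule atomless_finite_law[OF atomless finite_lessThan unif]) (rule that; assumption)
    have N_less: "N x < k" for x using measurable_space[OF N(1), of x] sQ by simp
    define B where "B s = {x. N x = s}" for s
    have B [measurable]: "B s \<in> sets borel" if "s < k" for s
      using measurable_sets[OF N(1), of "{s}"] that sQ by (simp add: vimage_def B_def)
    define g :: "nat \<Rightarrow> real \<Rightarrow> real" where "g s = indicator (B s)" for s
    have g_meas: "g s \<in> borel_measurable borel" if "s < k" for s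
      unfolding g_def using B[OF that] by simp
    have gg: "g s x * g s x = g s x" for s x by (simp add: g_def indicator_def)
    have int: "integrable M (\<lambda>\<omega>. g s (X i \<omega>))" if "s < k" for i s
      using measurable_compose[OF X_meas g_meas[OF that]]
      by (intro integrable_const_bound[where B = 1]) (auto simp: g_def indicator_def)
    have mean: "integral\<^sup>L M (\<lambda>\<omega>. g s (X i \<omega>)) = 1 / k" if "s < k" for i s
    proof -
      have "integral\<^sup>L M (\<lambda>\<omega>. g s (X i \<omega>)) = integral\<^sup>L Q (g s)"
        unfolding Q[of i, symmetric] using g_meas[OF that] by (subst integral_distr) auto
      also have "\<dots> = 1 / k" using N(2)[of s] that sQ by (simp add: g_def B_def)
      finally show ?thesis .
    qed
    have L2: "L2 M (g s \<circ> X i)" if "s < k" for i s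
      unfolding L2_def
    proof (intro conjI notI)
      show "g s \<circ> X i \<in> borel_measurable M" using measurable_compose[OF X_meas g_meas[OF that]] by (simp add: comp_def)
      show "integrable M (\<lambda>\<omega>. ((g s \<circ> X i) \<omega>)\<^sup>2)" using int[OF that] by (simp add: power2_eq_square gg)
      assume "\<exists>c. AE \<omega> in M. (g s \<circ> X i) \<omega> = c"
      then obtain c where c: "AE \<omega> in M. g s (X i \<omega>) = c" by auto
      have "integral\<^sup>L M (\<lambda>\<omega>. g s (X i \<omega>)) = integral\<^sup>L M (\<lambda>\<omega>. c)"
        using c int[OF that] by (intro integral_cong_AE) auto
      \<comment> \<open>An almost surely constant indicator has mean 0 or 1, but here the mean is
        1/k with \<open>k \<ge> 2\<close>.\<close>
      moreover have "AE \<omega> in M. c \<in> {0, 1}" using c by eventually_elim (auto simp: g_def indicator_def)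
      then have "c \<in> {0, 1}" by simp
      ultimately show False using mean[OF that, of i] k by (auto simp: prob_space)
    qed
    have joint: "integral\<^sup>L M (\<lambda>\<omega>. g s (X i \<omega>) * g s (X j \<omega>)) = R $ i $ j * (1 / k) + (1 - R $ i $ j) * (1 / k)\<^sup>2"
      if "s < k" for i j s
    proof -
      have "corr M (g s \<circ> X i) (g s \<circ> X j) = R $ i $ j"
        using inv[of i j] L2[OF that] g_meas[OF that] by (simp add: inv_corr_def)
      then show ?thesis
        using corr_eq_same_moments[OF prob_space_axioms L2[OF that, of i] L2[OF that, of j], of "R $ i $ j"]
          mean[OF that] by (simp add: comp_def gg)
    qed
    \<comment> \<open>\<open>Z i s\<close> records whether \<open>X i\<close> falls into cell
      \<open>s\<close>, so each row marks exactly one cell.\<close>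
    define Z where "Z i s \<omega> = g s (X i \<omega>)" for i s \<omega>
    have "(\<Sum>s<k. Z i s \<omega>) = 1" for i \<omega>
      using N_less[of "X i \<omega>"] by (simp add: Z_def g_def B_def indicator_def)
    moreover have "integral\<^sup>L M (\<lambda>\<omega>. \<Sum>s<k. Z i s \<omega> * Z j s \<omega>) = 1 / real k + R $ i $ j * (1 - 1 / real k)" for i j
    proof -
      have "integral\<^sup>L M (\<lambda>\<omega>. \<Sum>s<k. Z i s \<omega> * Z j s \<omega>) = (\<Sum>s<k. integral\<^sup>L M (\<lambda>\<omega>. Z i s \<omega> * Z j s \<omega>))"
        using L2_integrable_mult[OF L2 L2] by (intro Bochner_Integration.integral_sum) (simp add: Z_def comp_def)
      also have "\<dots> = k * (R $ i $ j * (1 / k) + (1 - R $ i $ j) * (1 / k)\<^sup>2)"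
        by (simp add: Z_def joint)
      also have "\<dots> = 1 / real k + R $ i $ j * (1 - 1 / real k)"
        using k by (simp add: field_simps power2_eq_square)
      finally show ?thesis .
    qed
    moreover have "Z i s \<in> borel_measurable M" if "s < k" for i s
      unfolding Z_def using measurable_compose[OF X_meas g_meas[OF that]] .
    moreover have "Z i s \<omega> \<in> {0, 1}" for i s \<omega> by (simp add: Z_def g_def indicator_def)
    ultimately have "(\<chi> i j. 1 / real k + R $ i $ j * (1 - 1 / real k)) \<in> (Zset M k :: (real^'n^'n) set)"
      by (intro ZsetI[of k Z]) simp_all
    then show ?thesis using Zset_subset_hull[OF assms] by blast
  qed
  have cl: "closed (convex hull (Sset CARD('n) :: (real^'n^'n) set))"
    by (intro compact_imp_closed compact_convex_hull finite_imp_compact finite_Sset)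
  have "(\<lambda>k. 1 / real k + R $ i $ j * (1 - 1 / real k)) \<longlonglongrightarrow> 0 + R $ i $ j * (1 - 0)" for i j
    by (intro tendsto_intros lim_1_over_n)
  then have lim: "(\<lambda>k. (\<chi> i j. 1 / real k + R $ i $ j * (1 - 1 / real k))) \<longlonglongrightarrow> R"
    by (intro vec_tendstoI) simp
  have ev: "eventually (\<lambda>k. (\<chi> i j. 1 / real k + R $ i $ j * (1 - 1 / real k)) \<in> convex hull (Sset CARD('n) :: (real^'n^'n) set)) sequentially"
    using approx by (auto simp: eventually_sequentially)
  show "R \<in> convex hull (Sset CARD('n))"
    by (rule Lim_in_closed_set[OF cl ev sequentially_bot lim])
qed

text \<open>Given the clique partition \<open>P\<close> drawn with weight \<open>u P\<close> (through \<open>V 0\<close>), the vector takes on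
  each block the value of one of the independent variables \<open>V 1, V 2, \<dots>\<close>, all independent of the draw.\<close>

lemma hull_subset_Theta:
  assumes "atomless_space M"
  shows "convex hull (Sset k) \<subseteq> (Theta M :: (real^'n::finite^'n) set)"
proof
  interpret prob_space M using assms by (simp add: atomless_space_def)
  fix R :: "real^'n^'n" assume R_hull: "R \<in> convex hull (Sset k)"
  define S where "S = (Sset k :: (real^'n^'n) set)"
  obtain u and F :: "real^'n^'n \<Rightarrow> 'n \<Rightarrow> nat" where
    u: "\<And>P. P \<in> S \<Longrightarrow> 0 \<le> u P" "sum u S = 1" and "\<And>P i. P \<in> S \<Longrightarrow> F P i < k"
    and R: "\<And>i j. R $ i $ j = (\<Sum>P\<in>S. u P * of_bool (F P i = F P j))"
    by (rule hull_Sset_weights[OF R_hull, folded S_def]) (rule that; assumption)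
  have fin: "finite S" by (simp add: S_def finite_Sset)
  obtain V :: "nat \<Rightarrow> 'a \<Rightarrow> real" where
    indep: "indep_vars (\<lambda>_. borel) V UNIV"
    and V_meas: "\<And>m. V m \<in> borel_measurable M"
    and same: "\<And>m m'. distr M borel (V m) = distr M borel (V m')"
    and cont: "\<And>m x. measure M {\<omega> \<in> space M. V m \<omega> = x} = 0"
    and bound: "\<And>m \<omega>. \<bar>V m \<omega>\<bar> \<le> 2"
    by (rule atomless_iid_continuous[OF assms]) (rule that; assumption)
  note [measurable] = V_meas
  define Q where "Q = distr M borel (V 0)"
  have Q: "distr M borel (V m) = Q" for m unfolding Q_def by (rule same)
  interpret Q: prob_space Q unfolding Q_def by (rule prob_space_distr) simp
  have sQ: "sets Q = sets borel" "space Q = UNIV" by (simp_all add: Q_def)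
  have Q_point: "measure Q {x} = 0" for x
    using cont[of 0 x] by (simp add: Q_def measure_distr vimage_def Collect_conj_eq Int_commute)
  then have "atomless_space Q"
    by (intro atomless_space_borel Q.prob_space_axioms sQ)
  \<comment> \<open>The random clique partition is built on the real line under \<open>Q\<close>, so
    that it is a function of \<open>V 0\<close> alone and hence independent of the other
    variables.\<close>
  from atomless_finite_law[OF this fin u] obtain h where h: "h \<in> measurable Q (count_space S)"
    and h_law: "\<And>P. P \<in> S \<Longrightarrow> measure Q {x \<in> space Q. h x = P} = u P"
    by blast
  have h_S: "h x \<in> S" for x using measurable_space[OF h, of x] sQ by simp
  define B where "B P = {x. h x = P}" for P
  have B: "B P \<in> sets borel" if "P \<in> S" for P
    using measurable_sets[OF h, of "{P}"] that sQ by (simp add: vimage_def B_def)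
  have B_law: "measure Q (B P) = u P" if "P \<in> S" for P using h_law[OF that] sQ by (simp add: B_def)
  \<comment> \<open>\<open>Suc\<close> shifts the block labels past index 0, which is reserved for
    the draw of the partition.\<close>
  define X where "X i \<omega> = V (Suc (F (h (V 0 \<omega>)) i)) \<omega>" for i \<omega>
  \<comment> \<open>Only the summand for the drawn partition survives. Allowing an arbitrary
    \<open>\<phi>\<close> of two arguments lets one identity yield measurability, the marginal law
    and the mixed moments.\<close>
  have decomp: "\<phi> (X i \<omega>) (X j \<omega>) = (\<Sum>P\<in>S. indicator (B P) (V 0 \<omega>) * \<phi> (V (Suc (F P i)) \<omega>) (V (Suc (F P j)) \<omega>))"
    for \<phi> :: "real \<Rightarrow> real \<Rightarrow> real" and i j \<omega>
  proof -
    have "(\<Sum>P\<in>S. indicator (B P) (V 0 \<omega>) * \<phi> (V (Suc (F P i)) \<omega>) (V (Suc (F P j)) \<omega>))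
        = (\<Sum>P\<in>S. if P = h (V 0 \<omega>) then \<phi> (X i \<omega>) (X j \<omega>) else 0)"
      by (intro sum.cong) (auto simp: B_def X_def indicator_def)
    then show ?thesis using h_S fin by simp
  qed
  have X_meas [measurable]: "X i \<in> borel_measurable M" for i
  proof -
    have "X i = (\<lambda>\<omega>. \<Sum>P\<in>S. indicator (B P) (V 0 \<omega>) * V (Suc (F P i)) \<omega>)"
      using decomp[of "\<lambda>x y. x" i _ i] by (auto simp: fun_eq_iff)
    moreover have "\<dots> \<in> borel_measurable M"
      using B by (intro borel_measurable_sum borel_measurable_times V_meas
          measurable_compose[OF V_meas borel_measurable_indicator])
    ultimately show ?thesis by simp
  qed
  have V_int: "integrable M (\<lambda>\<omega>. \<phi> (V m \<omega>))" "integral\<^sup>L M (\<lambda>\<omega>. \<phi> (V m \<omega>)) = integral\<^sup>L Q \<phi>"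
    if "integrable Q \<phi>" for \<phi> :: "real \<Rightarrow> real" and m
  proof -
    have \<phi>: "\<phi> \<in> borel_measurable borel"
      using borel_measurable_integrable[OF that] by (simp add: measurable_cong_sets[OF sQ(1) refl])
    show "integrable M (\<lambda>\<omega>. \<phi> (V m \<omega>))"
      using that \<phi> unfolding Q[of m, symmetric] by (subst (asm) integrable_distr_eq) auto
    show "integral\<^sup>L M (\<lambda>\<omega>. \<phi> (V m \<omega>)) = integral\<^sup>L Q \<phi>"
      using \<phi> unfolding Q[of m, symmetric] by (subst integral_distr) auto
  qed
  have prod: "integrable M (\<lambda>\<omega>. \<Prod>m\<in>J. Y m (V m \<omega>))"
      "integral\<^sup>L M (\<lambda>\<omega>. \<Prod>m\<in>J. Y m (V m \<omega>)) = (\<Prod>m\<in>J. integral\<^sup>L Q (Y m))"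
    if "finite J" "\<And>m. m \<in> J \<Longrightarrow> integrable Q (Y m)" for J and Y :: "nat \<Rightarrow> real \<Rightarrow> real"
  proof -
    have Y: "Y m \<in> borel_measurable borel" if "m \<in> J" for m
      using borel_measurable_integrable[OF \<open>\<And>m. m \<in> J \<Longrightarrow> integrable Q (Y m)\<close>[OF that]]
      by (simp add: measurable_cong_sets[OF sQ(1) refl])
    have "indep_vars (\<lambda>_. borel) V J" using indep by (rule indep_vars_subset) simp
    then have ind: "indep_vars (\<lambda>_. borel) (\<lambda>m \<omega>. Y m (V m \<omega>)) J"
      by (rule indep_vars_compose2) (rule Y)
    show "integrable M (\<lambda>\<omega>. \<Prod>m\<in>J. Y m (V m \<omega>))"
      using that by (intro indep_vars_integrable[OF _ ind] V_int(1)) auto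
    show "integral\<^sup>L M (\<lambda>\<omega>. \<Prod>m\<in>J. Y m (V m \<omega>)) = (\<Prod>m\<in>J. integral\<^sup>L Q (Y m))"
      using that by (subst indep_vars_lebesgue_integral[OF _ ind]) (auto simp: V_int)
  qed
  have B_int: "integrable Q (indicator (B P) :: real \<Rightarrow> real)" "integral\<^sup>L Q (indicator (B P)) = u P" if "P \<in> S" for P
    using B[OF that] B_law[OF that] sQ by (auto intro!: integrable_real_indicator simp: Q.emeasure_eq_measure)
  have single: "integrable M (\<lambda>\<omega>. indicator (B P) (V 0 \<omega>) * \<phi> (V (Suc a) \<omega>))"
      "integral\<^sup>L M (\<lambda>\<omega>. indicator (B P) (V 0 \<omega>) * \<phi> (V (Suc a) \<omega>)) = u P * integral\<^sup>L Q \<phi>"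
    if "P \<in> S" "integrable Q \<phi>" for P a and \<phi> :: "real \<Rightarrow> real"
    using prod[of "{0, Suc a}" "\<lambda>m. if m = 0 then indicator (B P) else \<phi>"] that B_int[OF that(1)] by auto
  \<comment> \<open>Distinct \<open>a\<close> and \<open>c\<close> make 0, \<open>Suc a\<close> and
    \<open>Suc c\<close> three different indices, so the expectation factorises. For equal labels,
    \<open>single\<close> is applied to the square of \<open>\<phi>\<close> instead.\<close>
  have pair: "integrable M (\<lambda>\<omega>. indicator (B P) (V 0 \<omega>) * (\<phi> (V (Suc a) \<omega>) * \<phi> (V (Suc c) \<omega>)))"
      "integral\<^sup>L M (\<lambda>\<omega>. indicator (B P) (V 0 \<omega>) * (\<phi> (V (Suc a) \<omega>) * \<phi> (V (Suc c) \<omega>))) = u P * (integral\<^sup>L Q \<phi>)\<^sup>2"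
    if "P \<in> S" "integrable Q \<phi>" "a \<noteq> c" for P a c and \<phi> :: "real \<Rightarrow> real"
    using prod[of "{0, Suc a, Suc c}" "\<lambda>m. if m = 0 then indicator (B P) else \<phi>"] that B_int[OF that(1)]
    by (auto simp: power2_eq_square)
  \<comment> \<open>Whichever partition is drawn, \<open>X i\<close> is a variable of law
    \<open>Q\<close> independent of the draw; averaging over the partitions leaves
    \<open>Q\<close>.\<close>
  have law: "distr M borel (X i) = Q" for i
  proof (rule measure_eqI)
    fix A assume "A \<in> sets (distr M borel (X i))"
    then have A: "A \<in> sets borel" by simp
    have A_int: "integrable Q (indicator A :: real \<Rightarrow> real)"
      using A sQ by (auto intro!: integrable_real_indicator simp: Q.emeasure_eq_measure)
    have ev: "X i -` A \<inter> space M \<in> sets M" using measurable_sets[OF X_meas A] .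
    have "measure M (X i -` A \<inter> space M) = integral\<^sup>L M (indicator (X i -` A \<inter> space M))"
      using ev by simp
    also have "\<dots> = integral\<^sup>L M (\<lambda>\<omega>. indicator A (X i \<omega>))"
      by (intro Bochner_Integration.integral_cong) (auto simp: indicator_def)
    also have "\<dots> = integral\<^sup>L M (\<lambda>\<omega>. \<Sum>P\<in>S. indicator (B P) (V 0 \<omega>) * indicator A (V (Suc (F P i)) \<omega>))"
      using decomp[of "\<lambda>x y. indicator A x" i _ i] by simp
    also have "\<dots> = (\<Sum>P\<in>S. u P * measure Q A)"
      using single[OF _ A_int] A sQ by (subst Bochner_Integration.integral_sum) auto
    also have "\<dots> = measure Q A" by (simp add: sum_distrib_right[symmetric] u)
    finally show "emeasure (distr M borel (X i)) A = emeasure Q A"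
      using A by (simp add: emeasure_distr emeasure_eq_measure Q.emeasure_eq_measure)
  qed (simp add: sQ)
  have X_int: "integrable M (\<lambda>\<omega>. \<phi> (X i \<omega>)) \<longleftrightarrow> integrable Q \<phi>" "integral\<^sup>L M (\<lambda>\<omega>. \<phi> (X i \<omega>)) = integral\<^sup>L Q \<phi>"
    if "\<phi> \<in> borel_measurable borel" for \<phi> :: "real \<Rightarrow> real" and i
    unfolding law[of i, symmetric] using that by (simp_all add: integrable_distr_eq integral_distr)
  \<comment> \<open>A partition that joins \<open>i\<close> and \<open>j\<close> contributes the
    second moment, one that separates them the squared mean. The total weight of the joining
    partitions is \<open>R $ i $ j\<close>.\<close>
  have mixed: "integral\<^sup>L M (\<lambda>\<omega>. \<phi> (X i \<omega>) * \<phi> (X j \<omega>))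
      = R $ i $ j * integral\<^sup>L Q (\<lambda>x. \<phi> x * \<phi> x) + (1 - R $ i $ j) * (integral\<^sup>L Q \<phi>)\<^sup>2"
    if \<phi>: "integrable Q \<phi>" "integrable Q (\<lambda>x. \<phi> x * \<phi> x)" for \<phi> :: "real \<Rightarrow> real" and i j
  proof -
    let ?q = "integral\<^sup>L Q (\<lambda>x. \<phi> x * \<phi> x)" and ?m = "(integral\<^sup>L Q \<phi>)\<^sup>2"
    let ?T = "\<lambda>P \<omega>. indicator (B P) (V 0 \<omega>) * (\<phi> (V (Suc (F P i)) \<omega>) * \<phi> (V (Suc (F P j)) \<omega>))"
    have T: "integrable M (?T P) \<and> integral\<^sup>L M (?T P) = u P * (of_bool (F P i = F P j) * ?q + (1 - of_bool (F P i = F P j)) * ?m)"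
      if "P \<in> S" for P
      using single[OF that \<phi>(2), of "F P i"] pair[OF that \<phi>(1), of "F P i" "F P j"]
      by (cases "F P i = F P j") auto
    have "integral\<^sup>L M (\<lambda>\<omega>. \<phi> (X i \<omega>) * \<phi> (X j \<omega>)) = integral\<^sup>L M (\<lambda>\<omega>. \<Sum>P\<in>S. ?T P \<omega>)"
      using decomp[of "\<lambda>x y. \<phi> x * \<phi> y" i _ j] by simp
    also have "\<dots> = (\<Sum>P\<in>S. u P * (of_bool (F P i = F P j) * ?q + (1 - of_bool (F P i = F P j)) * ?m))"
      using T by (subst Bochner_Integration.integral_sum) auto
    also have "\<dots> = (\<Sum>P\<in>S. u P * of_bool (F P i = F P j) * (?q - ?m) + u P * ?m)"
      by (intro sum.cong) (auto simp: algebra_simps)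
    also have "\<dots> = R $ i $ j * (?q - ?m) + ?m"
      unfolding sum.distrib sum_distrib_right[symmetric] R u(2) by simp
    finally show ?thesis by (simp add: algebra_simps)
  qed
  have corr: "corr M (\<phi> \<circ> X i) (\<phi> \<circ> X j) = R $ i $ j"
    if \<phi>: "\<phi> \<in> borel_measurable borel" and L2: "L2 M (\<phi> \<circ> X i)" "L2 M (\<phi> \<circ> X j)" for \<phi> i j
  proof -
    have "integrable Q \<phi>"
      using L2_integrable[OF prob_space_axioms L2(1)] X_int(1)[OF \<phi>, of i] by (simp add: comp_def)
    moreover have "integrable Q (\<lambda>x. \<phi> x * \<phi> x)"
      using L2_integrable_mult[OF L2(1,1)] X_int(1)[of "\<lambda>x. \<phi> x * \<phi> x" i] \<phi> by (simp add: comp_def)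
    ultimately have "integral\<^sup>L M (\<lambda>\<omega>. \<phi> (X i \<omega>) * \<phi> (X j \<omega>))
      = R $ i $ j * integral\<^sup>L Q (\<lambda>x. \<phi> x * \<phi> x) + (1 - R $ i $ j) * (integral\<^sup>L Q \<phi>)\<^sup>2" by (rule mixed)
    then show ?thesis
      using corr_eq_same_moments[OF prob_space_axioms L2, of "R $ i $ j"]
        X_int(2)[OF \<phi>] X_int(2)[of "\<lambda>x. \<phi> x * \<phi> x"] \<phi> by (simp add: comp_def)
  qed
  have X_point: "measure M {\<omega> \<in> space M. X i \<omega> = x} = 0" for i x
    using Q_point[of x] unfolding law[of i, symmetric]
    by (simp add: measure_distr vimage_def Collect_conj_eq Int_commute)
  have X_L2: "L2 M (X i)" for i
    unfolding L2_def
  proof (intro conjI notI X_meas)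
    have "(X i \<omega>)\<^sup>2 \<le> 2\<^sup>2" for \<omega>
      using bound[of "Suc (F (h (V 0 \<omega>)) i)" \<omega>] by (intro abs_le_square_iff[THEN iffD1]) (simp add: X_def)
    then show "integrable M (\<lambda>\<omega>. (X i \<omega>)\<^sup>2)"
      by (intro integrable_const_bound[where B = "2\<^sup>2"]) auto
    \<comment> \<open>A variable without atoms cannot be almost surely constant.\<close>
    assume "\<exists>c. AE \<omega> in M. X i \<omega> = c"
    then obtain c where "AE \<omega> in M. X i \<omega> = c" by blast
    then have "measure M {\<omega> \<in> space M. X i \<omega> = c} = 1" by (subst prob_Collect_eq_1) auto
    then show False using X_point by simp
  qed
  have R_bounds: "R $ i $ j \<in> {-1..1}" for i j
  proof -
    have "0 \<le> R $ i $ j" unfolding R using u by (intro sum_nonneg) auto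
    moreover have "R $ i $ j \<le> sum u S" unfolding R using u by (intro sum_mono) auto
    ultimately show ?thesis using u by simp
  qed
  have "inv_corr M (X i) (X j) (R $ i $ j)" for i j
    unfolding inv_corr_def using X_L2 R_bounds corr[of id i j] corr[of _ i j] by (auto simp: id_comp)
  then show "R \<in> Theta M"
    unfolding Theta_def using X_point law by (auto intro!: exI[of _ X])
qed

theorem theorem4:
  fixes M :: "'a measure"
  assumes "atomless_space M"
    and "CARD('n::finite) \<ge> 2"
  shows "(Theta M :: (real^'n^'n) set) = Zset M CARD('n)
         \<and> (Zset M CARD('n) :: (real^'n^'n) set) = (\<Union>k. Zset M k)
         \<and> (Zset M CARD('n) :: (real^'n^'n) set) = convex hull (Sset CARD('n))"
proof -
  have prob: "prob_space M" using assms(1) by (simp add: atomless_space_def)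
  let ?C = "convex hull (Sset CARD('n)) :: (real^'n^'n) set"
  have Z: "(Zset M CARD('n) :: (real^'n^'n) set) = ?C"
    using Zset_subset_hull[OF prob] hull_subset_Zset[OF assms(1)] by (intro equalityI)
  moreover have "(Theta M :: (real^'n^'n) set) = ?C"
    using Theta_subset_hull[OF prob] hull_subset_Theta[OF assms(1)] by (intro equalityI)
  \<comment> \<open>The hull bounds \<open>Zset M k\<close> for every \<open>k\<close>, and
    \<open>k = CARD('n)\<close> already attains it.\<close>
  moreover have "(\<Union>k. Zset M k) = ?C"
    using Z Zset_subset_hull[OF prob] by blast
  ultimately show ?thesis by simp
qed

end
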